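(* Let $0<\alpha<\pi/6$ with $\alpha/2\pi$ irrational, and let $S:[0,1)\times[0,\pi]\to[0,1)\times[0,\pi]$, the measure $\lambda\otimes\mu$ and the $\sigma$-algebra $\mathcal{F}$ be as defined in the context. Then for every $A\in\mathcal{F}$ with $(\lambda\otimes\mu)(A)>0$, $$\lim_{n\to\infty}(\lambda\otimes\mu)\left(S^{n}(A)\right)=1 .$$ In other words, $S$ is an exact endomorphism of $\left([0,1)\times[0,\pi],\mathcal{F},\lambda\otimes\mu\right)$.
   Context: Let $0<\alpha<\pi/6$. Put $u_{\beta}(\theta)=\frac12\left(1+\frac{\tan\beta}{\tan\theta}\right)$ (with $1/\tan(\theta)=\cot(\theta)$, so that it equals $0$ at $\theta=\pi/2$). Define maps on $[0,\pi]$ with values in $\mathbb{R}$: $\tau_1(\theta)=\theta+2\alpha$, $\tau_2(\theta)=-\theta+2\pi-4\alpha$, $\tau_3(\theta)=\theta-2\alpha$, $\tau_4(\theta)=-\theta+4\alpha$. Define $p_1,\dots,p_4:[0,\pi]\to[0,1]$ by: $p_1(\theta)=1$ on $[0,\alpha)$, $u_\alpha(\theta)$ on $[\alpha,\pi-3\alpha)$, $2\cos(2\alpha)u_{2\alpha}(\theta)$ on $[\pi-3\alpha,\pi-2\alpha)$, $0$ on $[\pi-2\alpha,\pi]$; $p_2(\theta)=0$ on $[0,\pi-3\alpha)$, $u_\alpha(\theta)-2\cos(2\alpha)u_{2\alpha}(\theta)$ on $[\pi-3\alpha,\pi-2\alpha)$, $u_\alpha(\theta)$ on $[\pi-2\alpha,\pi-\alpha)$,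 $0$ on $[\pi-\alpha,\pi]$; $p_3(\theta)=0$ on $[0,2\alpha)$, $2\cos(2\alpha)u_{2\alpha}(-\theta)$ on $[2\alpha,3\alpha)$, $u_\alpha(-\theta)$ on $[3\alpha,\pi-\alpha)$, $1$ on $[\pi-\alpha,\pi]$; $p_4(\theta)=0$ on $[0,\alpha)$, $u_\alpha(-\theta)$ on $[\alpha,2\alpha)$, $u_\alpha(-\theta)-2\cos(2\alpha)u_{2\alpha}(-\theta)$ on $[2\alpha,3\alpha)$, $0$ on $[3\alpha,\pi]$. One has $\sum_k p_k=1$, and $\tau_k(\theta)\in[0,\pi]$ whenever $p_k(\theta)>0$. For $k=1,\dots,4$ let $J_k=\{(y,x)\in[0,1)\times[0,\pi] : \sum_{i<k}p_i(x)\le y<\sum_{i\le k}p_i(x)\}$; these sets partition $[0,1)\times[0,\pi]$. The skew-type representation is the map $S(y,x)=\left(\frac{1}{p_k(x)}\left(y-\sum_{i=1}^{k-1}p_i(x)\right),\tau_k(x)\right)$ for $(y,x)\in J_k$. $\lambda$ is Lebesgue measure on $[0,1)$, $\mu(A)=\frac12\int_A\sin(\theta)\,d\theta$ for Borel $A\subseteq[0,\pi]$, and $\pi_2:[0,1)\times[0,\pi]\to[0,\pi]$ is the projection on the second factor. $S$ preserves $\lambda\otimes\mu$. For $i_1,\dots,i_n\in\{1,\dots,4\}$ let $J_{i_1\cdots i_n}=\{\omega\in J_{i_n} : S(\omega)\in J_{i_{n-1}},S^2(\omega)\in J_{i_{n-2}},\dots,S^{n-1}(\omega)\in J_{i_1}\}$.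 For $n\ge1$ let $\mathcal{F}_n$ be the $\sigma$-algebra generated by the sets $\pi_2^{-1}(U)\cap J_{i_1\cdots i_n}$ with $U\in\mathcal{B}([0,\pi])$ and $i_1,\dots,i_n\in\{1,\dots,4\}$, and let $\mathcal{F}=\sigma\left(\bigcup_{n\ge1}\mathcal{F}_n\right)$. A measurable measure-preserving map $T$ of a probability space $(\Omega,\mathcal{G},P)$ is exact if $\bigcap_{n\ge0}T^{-n}(\mathcal{G})$ contains only sets of $P$-measure $0$ or $1$. *)

theory Defs
  imports "HOL-Probability.Probability"
begin

definition u_fun :: "real \<Rightarrow> real \<Rightarrow> real" where
  "u_fun \<beta> \<theta> = 1 / 2 * (1 + tan \<beta> * cot \<theta>)"

text \<open>
  The functions \<open>p1\<close>, ..., \<open>p4\<close> and the maps \<open>tau\<close> are only used for arguments in \<open>[0, \<pi>]\<close>;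
  their values elsewhere are irrelevant.
\<close>

definition p1 :: "real \<Rightarrow> real \<Rightarrow> real" where
  "p1 \<alpha> \<theta> =
     (if \<theta> < \<alpha> then 1
      else if \<theta> < pi - 3 * \<alpha> then u_fun \<alpha> \<theta>
      else if \<theta> < pi - 2 * \<alpha> then 2 * cos (2 * \<alpha>) * u_fun (2 * \<alpha>) \<theta>
      else 0)"

definition p2 :: "real \<Rightarrow> real \<Rightarrow> real" where
  "p2 \<alpha> \<theta> =
     (if \<theta> < pi - 3 * \<alpha> then 0
      else if \<theta> < pi - 2 * \<alpha> then u_fun \<alpha> \<theta> - 2 * cos (2 * \<alpha>) * u_fun (2 * \<alpha>) \<theta>
      else if \<theta> < pi - \<alpha> then u_fun \<alpha> \<theta>
      else 0)"

definition p3 :: "real \<Rightarrow> real \<Rightarrow> real" where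
  "p3 \<alpha> \<theta> =
     (if \<theta> < 2 * \<alpha> then 0
      else if \<theta> < 3 * \<alpha> then 2 * cos (2 * \<alpha>) * u_fun (2 * \<alpha>) (- \<theta>)
      else if \<theta> < pi - \<alpha> then u_fun \<alpha> (- \<theta>)
      else 1)"

definition p4 :: "real \<Rightarrow> real \<Rightarrow> real" where
  "p4 \<alpha> \<theta> =
     (if \<theta> < \<alpha> then 0
      else if \<theta> < 2 * \<alpha> then u_fun \<alpha> (- \<theta>)
      else if \<theta> < 3 * \<alpha> then u_fun \<alpha> (- \<theta>) - 2 * cos (2 * \<alpha>) * u_fun (2 * \<alpha>) (- \<theta>)
      else 0)"

definition prob_k :: "real \<Rightarrow> nat \<Rightarrow> real \<Rightarrow> real" where
  "prob_k \<alpha> k = (if k = 1 then p1 \<alpha> else if k = 2 then p2 \<alpha> else if k = 3 then p3 \<alpha> else p4 \<alpha>)"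

definition tau :: "real \<Rightarrow> nat \<Rightarrow> real \<Rightarrow> real" where
  "tau \<alpha> k \<theta> =
     (if k = 1 then \<theta> + 2 * \<alpha>
      else if k = 2 then - \<theta> + 2 * pi - 4 * \<alpha>
      else if k = 3 then \<theta> - 2 * \<alpha>
      else - \<theta> + 4 * \<alpha>)"

definition Omega :: "(real \<times> real) set" where
  "Omega = {0..<1} \<times> {0..pi}"

definition J_set :: "real \<Rightarrow> nat \<Rightarrow> (real \<times> real) set" where
  "J_set \<alpha> k = {(y, x) \<in> Omega. (\<Sum>i = 1..<k. prob_k \<alpha> i x) \<le> y \<and> y < (\<Sum>i = 1..k. prob_k \<alpha> i x)}"

definition J_index :: "real \<Rightarrow> real \<times> real \<Rightarrow> nat" where
  "J_index \<alpha> \<omega> = (THE k. k \<in> {1..4} \<and> \<omega> \<in> J_set \<alpha> k)"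

text \<open>Since the sets \<open>J_set \<alpha> 1\<close>, ..., \<open>J_set \<alpha> 4\<close> partition \<open>Omega\<close>, this is well defined on \<open>Omega\<close>;
  outside \<open>Omega\<close> the value is unspecified and never used.\<close>

definition S_map :: "real \<Rightarrow> real \<times> real \<Rightarrow> real \<times> real" where
  "S_map \<alpha> = (\<lambda>(y, x). let k = J_index \<alpha> (y, x)
     in (1 / prob_k \<alpha> k x * (y - (\<Sum>i = 1..<k. prob_k \<alpha> i x)), tau \<alpha> k x))"

definition lam :: "real measure" where
  "lam = restrict_space lborel {0..<1}"

definition mu :: "real measure" where
  "mu = density (restrict_space lborel {0..pi}) (\<lambda>\<theta>. ennreal (1 / 2 * sin \<theta>))"

definition lam_mu :: "(real \<times> real) measure" where
  "lam_mu = lam \<Otimes>\<^sub>M mu"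

text \<open>The word \<open>i\<^sub>1 \<dots> i\<^sub>n\<close> is the list \<open>[i\<^sub>1, \<dots>, i\<^sub>n]\<close>; the condition on the \<open>m\<close>-th iterate
  of \<open>\<omega>\<close> involves the letter \<open>i\<^bsub>n - m\<^esub>\<close>, i.e. the word is read from right to left along the orbit.\<close>

definition J_word :: "real \<Rightarrow> nat list \<Rightarrow> (real \<times> real) set" where
  "J_word \<alpha> is =
     {\<omega> \<in> Omega. \<forall>m < length is. (S_map \<alpha> ^^ m) \<omega> \<in> J_set \<alpha> (is ! (length is - Suc m))}"

definition sigma_Fn :: "real \<Rightarrow> nat \<Rightarrow> (real \<times> real) measure" where
  "sigma_Fn \<alpha> n = sigma Omega
     {snd -` U \<inter> J_word \<alpha> is | U is.
        U \<in> sets (restrict_space borel {0..pi}) \<and> length is = n \<and> set is \<subseteq> {1..4}}"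

definition sigma_F :: "real \<Rightarrow> (real \<times> real) measure" where
  "sigma_F \<alpha> = sigma Omega (\<Union>n\<in>{1..}. sets (sigma_Fn \<alpha> n))"

definition measure_preserving :: "'a measure \<Rightarrow> ('a \<Rightarrow> 'a) \<Rightarrow> bool" where
  "measure_preserving M T \<longleftrightarrow> T \<in> measurable M M \<and> distr M M T = M"

definition exact_endomorphism :: "'a measure \<Rightarrow> ('a \<Rightarrow> 'a) \<Rightarrow> bool" where
  "exact_endomorphism M T \<longleftrightarrow>
     prob_space M \<and> measure_preserving M T \<and>
     (\<forall>A \<in> (\<Inter>n. {(T ^^ n) -` B \<inter> space M | B. B \<in> sets M}).
        measure M A = 0 \<or> measure M A = 1)"

end

theory Submission
  imports Defs
begin

text \<open>
  The Markov chain with transitions \<open>x \<rightarrow> tau k x\<close> of probability \<open>p k x\<close> is reversible with respect to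
  the sine law: the weights \<open>p k x * sin x\<close> satisfy detailed balance, where branches 1 and 3 are
  inverse to each other and branches 2 and 4 are involutions.

  For \<open>A\<close> in \<open>\<F>\<close> put \<open>C n = (\<Union>m. S\<^sup>-\<^sup>m (S\<^sup>m\<^sup>+\<^sup>n A))\<close>, so that \<open>C n = S\<^sup>-\<^sup>1 (C (n + 1))\<close>, and let \<open>\<phi> n x\<close> be the
  measure of the fibre of \<open>C n\<close> over \<open>x\<close>. Then \<open>\<phi> n = Q (\<phi> (n + 1))\<close> for the self-adjoint transition operator
  \<open>Q\<close>, and hence the inner product of \<open>\<phi> n\<close> and \<open>\<phi> m\<close> depends on \<open>n + m\<close> only. This makes the sequence
  \<open>\<phi> (2 * n)\<close> Cauchy in \<open>L\<^sup>2\<close> and makes \<open>\<phi> (n + 1) (tau k x) - \<phi> n x\<close> tend to zero along almost every edge. A limit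
  is invariant under two steps of the chain. Unfolded to the circle, it is invariant under the
  rotation by \<open>4 * \<alpha>\<close>, hence constant, and comparing \<open>L\<^sup>2\<close> norms shows that every \<open>\<phi> n\<close> is already constant.

  Since \<open>S\<^sup>n\<close> maps the fibres of a cylinder of length \<open>n\<close> affinely onto full fibres, \<open>C 0\<close> is then independent of
  all cylinders, hence of \<open>\<F>\<close> and in particular of \<open>A\<close>, which it contains. So it has measure 1, and this
  measure is the limit of the measures of \<open>S\<^sup>n A\<close>.
\<close>

section \<open>Transition weights\<close>

definition reverse_branch :: "nat \<Rightarrow> nat" where
  "reverse_branch k = (if k = 1 then 3 else if k = 3 then 1 else k)"

lemma reverse_branch_in: "k \<in> {1..4} \<Longrightarrow> reverse_branch k \<in> {1..4}"
  by (auto simp: reverse_branch_def)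

lemma reverse_branch_reverse_branch [simp]: "reverse_branch (reverse_branch k) = k"
  by (simp add: reverse_branch_def)

lemma atLeast1_atMost4: "{1..4::nat} = {1, 2, 3, 4}"
  by auto

lemma index_cases:
  assumes "k \<in> {1..4::nat}"
  obtains "k = 1" | "k = 2" | "k = 3" | "k = 4"
  using assms unfolding atLeast1_atMost4 by blast

lemma sum_1_4: "(\<Sum>i = 1..4::nat. f i) = f 1 + f 2 + f 3 + (f 4 :: 'a :: comm_monoid_add)"
  by (simp add: atLeast1_atMost4 add.assoc del: One_nat_def)

lemma tau_reverse_branch_tau [simp]: "tau \<alpha> (reverse_branch k) (tau \<alpha> k x) = x"
  by (auto simp: tau_def reverse_branch_def)

lemma tau_tau_reverse_branch [simp]: "tau \<alpha> k (tau \<alpha> (reverse_branch k) x) = x"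
  using tau_reverse_branch_tau[of \<alpha> "reverse_branch k" x] by simp

text \<open>Multiplying by the sine clears the cotangent. For \<open>\<beta> = 2 * \<alpha>\<close>
  the denominator then cancels the factor \<open>2 * cos (2 * \<alpha>)\<close> in the branch
  probabilities.\<close>

lemma u_fun_times_sin:
  assumes "sin x \<noteq> 0" "cos \<beta> \<noteq> 0"
  shows "u_fun \<beta> x * sin x = sin (x + \<beta>) / (2 * cos \<beta>)"
  using assms by (simp add: u_fun_def tan_def cot_def sin_add field_simps)

lemma u_fun_minus_times_sin:
  assumes "sin x \<noteq> 0" "cos \<beta> \<noteq> 0"
  shows "u_fun \<beta> (- x) * sin x = sin (x - \<beta>) / (2 * cos \<beta>)"
  using assms by (simp add: u_fun_def tan_def cot_def sin_diff field_simps)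

lemma prob_k_measurable [measurable]: "prob_k \<alpha> k \<in> borel_measurable borel"
proof -
  have [measurable]: "(\<lambda>x. u_fun \<beta> x) \<in> borel_measurable borel" for \<beta>
    unfolding u_fun_def cot_def by measurable
  have [measurable]: "(\<lambda>x. p1 \<alpha> x) \<in> borel_measurable borel" "(\<lambda>x. p2 \<alpha> x) \<in> borel_measurable borel"
     "(\<lambda>x. p3 \<alpha> x) \<in> borel_measurable borel" "(\<lambda>x. p4 \<alpha> x) \<in> borel_measurable borel"
    unfolding p1_def p2_def p3_def p4_def by measurable
  show ?thesis
    unfolding prob_k_def by simp
qed

lemma tau_measurable [measurable]: "tau \<alpha> k \<in> borel_measurable borel"
  unfolding tau_def by measurable

text \<open>Extended by zero off \<open>[0, pi]\<close>, so that detailed balance and affine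
  substitutions hold on the whole line without range conditions.\<close>

definition weight :: "real \<Rightarrow> nat \<Rightarrow> real \<Rightarrow> real" where
  "weight \<alpha> k x = (if 0 \<le> x \<and> x \<le> pi then prob_k \<alpha> k x * sin x else 0)"

locale small_angle =
  fixes \<alpha> :: real
  assumes alpha_pos: "0 < \<alpha>" and alpha_less: "\<alpha> < pi / 6"
begin

abbreviation "p \<equiv> prob_k \<alpha>"
abbreviation "\<tau> \<equiv> tau \<alpha>"

lemma cos_pos: "cos \<alpha> > 0" "cos (2 * \<alpha>) > 0"
  using alpha_pos alpha_less by (auto intro!: cos_gt_zero)

lemma half_quotient_eq: "a + b = 2 * z * c \<Longrightarrow> y = - b \<Longrightarrow> c > 0 \<Longrightarrow> a / (2 * c) - z = y / (2 * c)"
  for a b c y z :: real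
  by (simp add: eq_diff_eq[symmetric] diff_divide_distrib)

text \<open>A product-to-sum formula centred at \<open>x + 2 * \<alpha>\<close>. It turns the
  difference in the definition of \<open>p2\<close>, once multiplied by the sine, into a single
  shifted sine whose sign is visible. The next identity but one in this style,
  \<open>sin_diff_double\<close>, does the same for \<open>p4\<close>.\<close>

lemma sin_add_double:
  "sin (x + \<alpha>) / (2 * cos \<alpha>) - sin (x + 2 * \<alpha>) = sin (x - (pi - 3 * \<alpha>)) / (2 * cos \<alpha>)"
proof -
  have "sin ((x + 2 * \<alpha>) - \<alpha>) + sin ((x + 2 * \<alpha>) + \<alpha>) = 2 * sin (x + 2 * \<alpha>) * cos \<alpha>"
    unfolding sin_add sin_diff by simp
  moreover have "sin (x - (pi - 3 * \<alpha>)) = - sin ((x + 2 * \<alpha>) + \<alpha>)"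
    using sin_minus_pi[of "x + 3 * \<alpha>"] by (simp add: algebra_simps)
  ultimately show ?thesis using cos_pos by (intro half_quotient_eq) (simp_all add: algebra_simps)
qed

lemma sin_diff_double:
  "sin (x - \<alpha>) / (2 * cos \<alpha>) - sin (x - 2 * \<alpha>) = sin (3 * \<alpha> - x) / (2 * cos \<alpha>)"
proof -
  have "sin ((x - 2 * \<alpha>) - \<alpha>) + sin ((x - 2 * \<alpha>) + \<alpha>) = 2 * sin (x - 2 * \<alpha>) * cos \<alpha>"
    unfolding sin_add sin_diff by simp
  moreover have "sin (3 * \<alpha> - x) = - sin ((x - 2 * \<alpha>) - \<alpha>)"
    using sin_minus[of "3 * \<alpha> - x"] by (simp add: algebra_simps)
  ultimately show ?thesis using cos_pos by (intro half_quotient_eq) (simp_all add: algebra_simps)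
qed

lemma inner_sin_nz: "0 < x \<Longrightarrow> x < pi \<Longrightarrow> sin x \<noteq> 0"
  using sin_gt_zero[of x] by simp

lemma weight_1:
  "weight \<alpha> 1 x = (if x < 0 then 0 else if x < \<alpha> then sin x
     else if x < pi - 3 * \<alpha> then sin (x + \<alpha>) / (2 * cos \<alpha>)
     else if x < pi - 2 * \<alpha> then sin (x + 2 * \<alpha>) else 0)"
  using alpha_pos alpha_less cos_pos u_fun_times_sin[OF inner_sin_nz, of x \<alpha>]
    u_fun_times_sin[OF inner_sin_nz, of x "2 * \<alpha>"]
  by (auto simp: weight_def prob_k_def p1_def field_simps)

lemma weight_3:
  "weight \<alpha> 3 x = (if x < 2 * \<alpha> then 0 else if x < 3 * \<alpha> then sin (x - 2 * \<alpha>)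
     else if x < pi - \<alpha> then sin (x - \<alpha>) / (2 * cos \<alpha>)
     else if x < pi then sin x else 0)"
  using alpha_pos alpha_less cos_pos u_fun_minus_times_sin[OF inner_sin_nz, of x \<alpha>]
    u_fun_minus_times_sin[OF inner_sin_nz, of x "2 * \<alpha>"]
  by (auto simp: weight_def prob_k_def p3_def field_simps)

lemma weight_2:
  "weight \<alpha> 2 x = (if x < pi - 3 * \<alpha> then 0
     else if x < pi - 2 * \<alpha> then sin (x - (pi - 3 * \<alpha>)) / (2 * cos \<alpha>)
     else if x < pi - \<alpha> then sin (x + \<alpha>) / (2 * cos \<alpha>) else 0)"
  unfolding sin_add_double[symmetric]
  using alpha_pos alpha_less cos_pos u_fun_times_sin[OF inner_sin_nz, of x \<alpha>]
    u_fun_times_sin[OF inner_sin_nz, of x "2 * \<alpha>"]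
  by (auto simp: weight_def prob_k_def p2_def field_simps)

lemma weight_4:
  "weight \<alpha> 4 x = (if x < \<alpha> then 0
     else if x < 2 * \<alpha> then sin (x - \<alpha>) / (2 * cos \<alpha>)
     else if x < 3 * \<alpha> then sin (3 * \<alpha> - x) / (2 * cos \<alpha>) else 0)"
  unfolding sin_diff_double[symmetric]
  using alpha_pos alpha_less cos_pos u_fun_minus_times_sin[OF inner_sin_nz, of x \<alpha>]
    u_fun_minus_times_sin[OF inner_sin_nz, of x "2 * \<alpha>"]
  by (auto simp: weight_def prob_k_def p4_def field_simps)

text \<open>The shift carries the breakpoints 0, \<open>\<alpha>\<close>,
  \<open>pi - 3 * \<alpha>\<close>, \<open>pi - 2 * \<alpha>\<close> of branch 1 to the breakpoints
  \<open>2 * \<alpha>\<close>, \<open>3 * \<alpha>\<close>, \<open>pi - \<alpha>\<close>,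
  \<open>pi\<close> of branch 3 and matches the sines in between.\<close>

lemma weight_1_tau: "weight \<alpha> 3 (x + 2 * \<alpha>) = weight \<alpha> 1 x"
  using alpha_pos alpha_less
  unfolding weight_1 weight_3 by (auto simp: field_simps)

text \<open>Branches 2 and 4 are the reflections in \<open>pi - 2 * \<alpha>\<close> and
  \<open>2 * \<alpha>\<close>, which exchange the two sine pieces of their weights.\<close>

lemma detailed_balance:
  assumes "k \<in> {1..4}"
  shows "weight \<alpha> (reverse_branch k) (\<tau> k x) = weight \<alpha> k x"
  using assms
proof (cases rule: index_cases)
  case 1
  then show ?thesis using weight_1_tau[of x] by (simp add: reverse_branch_def tau_def)
next
  case 2
  define y where "y = 2 * pi - 4 * \<alpha> - x"
  have "sin (y - (pi - 3 * \<alpha>)) = sin (x + \<alpha>)"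
    using sin_pi_minus[of "x + \<alpha>"] by (simp add: y_def algebra_simps)
  moreover have "sin (y + \<alpha>) = sin (x - (pi - 3 * \<alpha>))"
    using sin_pi_minus[of "x - (pi - 3 * \<alpha>)"] by (simp add: y_def algebra_simps)
  moreover have "x + y \<le> 2 * pi - 4 * \<alpha>" "x + y \<ge> 2 * pi - 4 * \<alpha>"
    by (simp_all add: y_def)
  \<comment> \<open>The reflection does not respect half-open pieces: at
    \<open>pi - 3 * \<alpha>\<close> and its mirror point \<open>pi - \<alpha>\<close> the weights
    agree because both vanish.\<close>
  ultimately have "weight \<alpha> 2 y = weight \<alpha> 2 x"
    using alpha_pos alpha_less
    by (cases "y = pi - 3 * \<alpha>"; cases "x = pi - 3 * \<alpha>"; cases "y = x")
      (simp_all add: weight_2 not_less)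
  moreover have "\<tau> k x = y" "reverse_branch k = 2"
    using 2 by (auto simp: tau_def reverse_branch_def y_def)
  ultimately show ?thesis
    using 2 by simp
next
  case 3
  then show ?thesis using weight_1_tau[of "x - 2 * \<alpha>"] by (simp add: reverse_branch_def tau_def)
next
  case 4
  have "\<tau> k x = 4 * \<alpha> - x" "reverse_branch k = 4"
    using 4 by (auto simp: tau_def reverse_branch_def)
  with 4 show ?thesis
    using alpha_pos alpha_less
    by (auto simp: weight_4)
qed

lemma weight_pos:
  assumes "0 < x" "x < pi"
  shows "x < pi - 2 * \<alpha> \<Longrightarrow> weight \<alpha> 1 x > 0"
    "2 * \<alpha> < x \<Longrightarrow> weight \<alpha> 3 x > 0"
    "pi - 3 * \<alpha> < x \<Longrightarrow> x < pi - \<alpha> \<Longrightarrow> weight \<alpha> 2 x > 0"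
    "\<alpha> < x \<Longrightarrow> x < 3 * \<alpha> \<Longrightarrow> weight \<alpha> 4 x > 0"
  using assms alpha_pos alpha_less cos_pos unfolding weight_1 weight_2 weight_3 weight_4
  by (auto intro!: sin_gt_zero divide_pos_pos)

lemma weight_nonneg:
  assumes "k \<in> {1..4}"
  shows "weight \<alpha> k x \<ge> 0"
  using assms alpha_pos alpha_less cos_pos
  by (cases rule: index_cases)
    (auto simp: weight_1 weight_2 weight_3 weight_4 simp del: One_nat_def intro!: sin_ge_zero divide_nonneg_pos)

lemma sum_p:
  assumes "0 \<le> x" "x \<le> pi"
  shows "(\<Sum>k = 1..4. p k x) = 1"
proof -
  have "u_fun \<beta> x + u_fun \<beta> (- x) = 1" for \<beta>
    by (simp add: u_fun_def cot_def field_simps)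
  then show ?thesis
    using alpha_pos alpha_less assms unfolding sum_1_4
    by (auto simp: prob_k_def p1_def p2_def p3_def p4_def add.commute)
qed

text \<open>In the interior the sign is that of the weight; at 0 and \<open>pi\<close> the sine
  vanishes and the piecewise definitions decide.\<close>

lemma p_nonneg:
  assumes "k \<in> {1..4}" "0 \<le> x" "x \<le> pi"
  shows "p k x \<ge> 0"
proof (cases "x = 0 \<or> x = pi")
  case True
  then show ?thesis
    using assms alpha_pos alpha_less
    by (auto simp: prob_k_def p1_def p2_def p3_def p4_def)
next
  case False
  then have "sin x > 0" using assms by (auto intro!: sin_gt_zero)
  then show ?thesis
    using weight_nonneg[OF assms(1), of x] assms by (simp add: weight_def zero_le_mult_iff)
qed

lemma p_le_1:
  assumes "k \<in> {1..4}" "0 \<le> x" "x \<le> pi"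
  shows "p k x \<le> 1"
  using sum_p[OF assms(2,3)] assms
  by (metis member_le_sum[of k "{1..4}" "\<lambda>k. p k x"] finite_atLeastAtMost p_nonneg DiffE)

lemma tau_range:
  assumes "k \<in> {1..4}" "0 \<le> x" "x \<le> pi" "p k x > 0"
  shows "0 \<le> \<tau> k x" "\<tau> k x \<le> pi"
  using assms(1) assms(2-) alpha_pos alpha_less
  by (cases rule: index_cases;
      auto simp: tau_def prob_k_def p1_def p2_def p3_def p4_def split: if_splits)+

lemma p_pos_iff:
  assumes "0 < x" "x < pi"
  shows "p k x > 0 \<longleftrightarrow> weight \<alpha> k x > 0"
  using assms sin_gt_zero[of x] by (simp add: weight_def zero_less_mult_iff)

end

section \<open>The sine measure and fibre measures\<close>

text \<open>The measure \<open>mu\<close> carried to the whole line, so that measurability is Borel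
  measurability and substitutions can be made in \<open>lborel\<close>.\<close>

definition sine_measure :: "real measure" where
  "sine_measure = density lborel (\<lambda>x. ennreal (indicator {0..pi} x * (sin x / 2)))"

definition fibre_measure :: "(real \<times> real) set \<Rightarrow> real \<Rightarrow> real" where
  "fibre_measure B x = measure lborel {y. (y, x) \<in> B}"

lemma sine_density_nonneg: "0 \<le> indicator {0..pi} x * (sin x / 2)"
  by (auto simp: indicator_def intro: sin_ge_zero)

lemma space_sine_measure [simp]: "space sine_measure = UNIV"
  and sets_sine_measure [measurable_cong, simp]: "sets sine_measure = sets borel"
  by (simp_all add: sine_measure_def)

lemma has_integral_half_sin: "((\<lambda>x. sin x / 2) has_integral 1) {0..pi}"
proof -
  have "((\<lambda>x. sin x / 2) has_integral (- cos pi / 2 - (- cos 0 / 2))) {0..pi}"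
    by (intro fundamental_theorem_of_calculus)
      (auto intro!: derivative_eq_intros simp flip: has_real_derivative_iff_has_vector_derivative)
  then show ?thesis by simp
qed

lemma prob_space_sine_measure: "prob_space sine_measure"
proof
  have "emeasure sine_measure (space sine_measure) = (\<integral>\<^sup>+x. ennreal (indicator {0..pi} x * (sin x / 2)) \<partial>lborel)"
    by (simp add: sine_measure_def emeasure_density)
  also have "\<dots> = 1"
  proof -
    have "((\<lambda>x. indicator {0..pi} x * (sin x / 2)) has_integral 1) UNIV"
      using has_integral_half_sin
      by (subst (asm) has_integral_restrict_UNIV[symmetric]) (auto elim!: has_integral_eq_rhs has_integral_cong[THEN iffD1, rotated] simp: indicator_def if_distrib)
    from nn_integral_has_integral_lborel[OF _ _ this] show ?thesis
      using sine_density_nonneg by simp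
  qed
  finally show "emeasure sine_measure (space sine_measure) = 1" .
qed

interpretation sine: prob_space sine_measure
  by (rule prob_space_sine_measure)

section \<open>The product measure and its fibres\<close>

lemma space_lam_mu [simp]: "space lam_mu = Omega"
  by (simp add: lam_mu_def lam_def mu_def space_pair_measure space_restrict_space Omega_def)

text \<open>Measurable rectangles are Borel, and conversely the identity is Borel measurable on
  \<open>lam_mu\<close> because both projections are. This replaces the restricted product by plain
  Borel subsets of \<open>Omega\<close>.\<close>

lemma sets_lam_mu: "B \<in> sets lam_mu \<longleftrightarrow> B \<in> sets borel \<and> B \<subseteq> Omega"
proof -
  have *: "A \<in> sets borel" if "A \<in> sets lam" for A :: "real set"
    using that by (auto simp: lam_def sets_restrict_space_iff)
  have **: "A \<in> sets borel" "A \<subseteq> {0..pi}" if "A \<in> sets mu" for A :: "real set"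
    using that by (auto simp: mu_def sets_restrict_space_iff)
  have "sets lam_mu \<subseteq> sets borel"
    unfolding lam_mu_def by (rule sets_pair_in_sets) (auto intro!: borel_Times dest: * **)
  moreover have "B \<subseteq> Omega" if "B \<in> sets lam_mu"
    using sets.sets_into_space[OF that] by simp
  moreover have "B \<in> sets lam_mu" if "B \<in> sets borel" "B \<subseteq> Omega"
  proof -
    have "fst \<in> borel_measurable lam_mu" "snd \<in> borel_measurable lam_mu"
      unfolding lam_mu_def lam_def mu_def
      by (auto intro!: measurable_compose[OF measurable_fst] measurable_compose[OF measurable_snd]
          measurable_restrict_space1)
    then have "(\<lambda>\<omega>. (fst \<omega>, snd \<omega>)) \<in> borel_measurable lam_mu"
      by (rule borel_measurable_Pair)
    from measurable_sets[OF this that(1)] that(2) show ?thesis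
      by (simp add: Int_absorb2)
  qed
  ultimately show ?thesis by blast
qed

lemma Omega_borel [measurable]: "Omega \<in> sets borel"
  by (auto simp: Omega_def intro!: borel_Times)

lemma sets_lam_mu_borel [measurable_dest]: "B \<in> sets lam_mu \<Longrightarrow> B \<in> sets borel"
  by (simp add: sets_lam_mu)

lemma fibre_set_borel:
  assumes "B \<in> sets (borel :: (real \<times> real) measure)"
  shows "{y. (y, x) \<in> B} \<in> sets borel"
proof -
  have "(\<lambda>y. (y, x)) \<in> borel_measurable borel"
    by (intro borel_measurable_continuous_onI continuous_intros)
  from measurable_sets[OF this assms] show ?thesis by (simp add: vimage_def)
qed

lemma fibre_subset: "B \<subseteq> Omega \<Longrightarrow> {y. (y, x) \<in> B} \<subseteq> {0..<1}"
  by (auto simp: Omega_def)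

lemma fibre_measure_eq_0: "B \<subseteq> Omega \<Longrightarrow> x \<notin> {0..pi} \<Longrightarrow> fibre_measure B x = 0"
  unfolding fibre_measure_def Omega_def
  by (metis (no_types, lifting) Collect_empty_eq SigmaE2 measure_empty subsetD)

lemma fmeasurable_fibre:
  assumes "B \<in> sets lam_mu"
  shows "{y. (y, x) \<in> B} \<in> fmeasurable lborel"
proof (rule fmeasurableI2)
  show "{0..<1::real} \<in> fmeasurable lborel" by (auto intro: fmeasurableI)
  show "{y. (y, x) \<in> B} \<subseteq> {0..<1}" "{y. (y, x) \<in> B} \<in> sets lborel"
    using assms fibre_subset fibre_set_borel by (auto simp: sets_lam_mu)
qed

lemma emeasure_fibre:
  assumes "B \<in> sets lam_mu"
  shows "emeasure lborel {y. (y, x) \<in> B} = ennreal (fibre_measure B x)"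
  unfolding fibre_measure_def
  using fmeasurable_fibre[OF assms] by (simp add: emeasure_eq_measure2)

lemma fibre_measure_nonneg: "0 \<le> fibre_measure B x"
  by (simp add: fibre_measure_def)

lemma fibre_measure_le_1:
  assumes "B \<in> sets lam_mu" shows "fibre_measure B x \<le> 1"
proof -
  have "fibre_measure B x \<le> measure lborel {0..<1::real}"
    unfolding fibre_measure_def
    using assms fibre_subset fibre_set_borel
    by (intro measure_mono_fmeasurable) (auto simp: sets_lam_mu intro: fmeasurableI)
  then show ?thesis by simp
qed

lemma fibre_measure_measurable [measurable]:
  assumes "B \<in> sets lam_mu"
  shows "fibre_measure B \<in> borel_measurable borel"
proof -
  have "B \<in> sets (lborel \<Otimes>\<^sub>M lborel)"
    using assms by (subst lborel_prod) (simp add: sets_lam_mu)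
  from lborel_pair.measurable_emeasure_Pair2[OF this]
  have "(\<lambda>x. enn2real (emeasure lborel ((\<lambda>y. (y, x)) -` B))) \<in> borel_measurable borel"
    by measurable
  then show ?thesis
    by (simp add: fibre_measure_def[abs_def] measure_def vimage_def)
qed

lemma fibre_measure_Omega: "x \<in> {0..pi} \<Longrightarrow> fibre_measure Omega x = 1"
proof -
  assume "x \<in> {0..pi}"
  then have "{y. (y, x) \<in> Omega} = {0..<1}" by (auto simp: Omega_def)
  then show ?thesis by (simp add: fibre_measure_def)
qed

text \<open>The density is positive exactly on the open interval.\<close>

lemma AE_sine_measure_iff:
  "(AE x in sine_measure. P x) \<longleftrightarrow> (AE x in lborel. 0 < x \<and> x < pi \<longrightarrow> P x)"
proof -
  have "0 < indicator {0..pi} x * (sin x / 2) \<longleftrightarrow> 0 < x \<and> x < pi" for x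
    using sin_gt_zero[of x] by (cases "x = 0 \<or> x = pi") (auto simp: indicator_def)
  then show ?thesis
    unfolding sine_measure_def by (subst AE_density) auto
qed

lemma AE_sine_measure_range: "AE x in sine_measure. 0 < x \<and> x < pi"
  by (subst AE_sine_measure_iff) auto

lemma integrable_bounded:
  fixes f :: "real \<Rightarrow> real"
  assumes [measurable]: "f \<in> borel_measurable borel" and "\<And>x. 0 < x \<Longrightarrow> x < pi \<Longrightarrow> \<bar>f x\<bar> \<le> K"
  shows "integrable sine_measure f"
  using AE_sine_measure_range
  by (intro sine.integrable_const_bound[where B = K]) (auto intro: assms(2))

lemma nn_integral_mu:
  assumes [measurable]: "f \<in> borel_measurable borel"
  shows "(\<integral>\<^sup>+x. f x \<partial>mu) = (\<integral>\<^sup>+x. f x \<partial>sine_measure)"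
proof -
  have "(\<integral>\<^sup>+x. f x \<partial>mu) = (\<integral>\<^sup>+x. ennreal (sin x / 2) * f x \<partial>restrict_space lborel {0..pi})"
    unfolding mu_def by (subst nn_integral_density) (auto intro!: measurable_restrict_space1)
  also have "\<dots> = (\<integral>\<^sup>+x. ennreal (indicator {0..pi} x * (sin x / 2)) * f x \<partial>lborel)"
    by (subst nn_integral_restrict_space) (auto intro!: nn_integral_cong simp: indicator_def)
  also have "\<dots> = (\<integral>\<^sup>+x. f x \<partial>sine_measure)"
    unfolding sine_measure_def by (subst nn_integral_density) auto
  finally show ?thesis .
qed

text \<open>Tonelli, with the first coordinate integrated first; the fibres of a subset of
  \<open>Omega\<close> have the same measure in \<open>lam\<close> and in
  \<open>lborel\<close>.\<close>

lemma emeasure_lam_mu: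
  assumes "B \<in> sets lam_mu"
  shows "emeasure lam_mu B = (\<integral>\<^sup>+x. ennreal (fibre_measure B x) \<partial>sine_measure)"
proof -
  have "sigma_finite_measure lam"
    unfolding lam_def by (rule sigma_finite_measure_restrict_space) (auto simp: sigma_finite_lborel)
  moreover have "finite_measure mu"
    using nn_integral_mu[of "\<lambda>_. 1"] sine.emeasure_space_1 by (intro finite_measureI) simp
  then have "sigma_finite_measure mu"
    by (simp add: finite_measure_def)
  ultimately interpret pair_sigma_finite lam mu
    by (simp add: pair_sigma_finite_def)
  have [measurable]: "fibre_measure B \<in> borel_measurable borel"
    using assms by measurable
  have fib: "emeasure lam ((\<lambda>y. (y, x)) -` B) = ennreal (fibre_measure B x)" for x
    using fibre_subset[of B x] emeasure_fibre[OF assms, of x] assms fibre_set_borel[of B x]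
    by (simp add: lam_def emeasure_restrict_space sets_lam_mu vimage_def)
  have "emeasure lam_mu B = (\<integral>\<^sup>+x. emeasure lam ((\<lambda>y. (y, x)) -` B) \<partial>mu)"
    using assms unfolding lam_mu_def by (rule emeasure_pair_measure_alt2)
  also have "\<dots> = (\<integral>\<^sup>+x. ennreal (fibre_measure B x) \<partial>mu)"
    by (simp add: fib)
  also have "\<dots> = (\<integral>\<^sup>+x. ennreal (fibre_measure B x) \<partial>sine_measure)"
    by (rule nn_integral_mu) measurable
  finally show ?thesis .
qed

lemma measure_lam_mu:
  assumes "B \<in> sets lam_mu"
  shows "measure lam_mu B = (\<integral>x. fibre_measure B x \<partial>sine_measure)"
proof -
  have "integrable sine_measure (fibre_measure B)"
    using assms fibre_measure_le_1[OF assms] fibre_measure_nonneg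
    by (intro integrable_bounded[where K = 1]) auto
  from nn_integral_eq_integral[OF this] show ?thesis
    by (simp add: measure_def emeasure_lam_mu[OF assms] fibre_measure_nonneg integral_nonneg_AE)
qed

lemma prob_space_lam_mu: "prob_space lam_mu"
proof
  have "Omega \<in> sets lam_mu"
    using sets.top[of lam_mu] by simp
  then have "emeasure lam_mu Omega = (\<integral>\<^sup>+x. ennreal (fibre_measure Omega x) \<partial>sine_measure)"
    by (rule emeasure_lam_mu)
  also have "\<dots> = (\<integral>\<^sup>+x. 1 \<partial>sine_measure)"
    using AE_sine_measure_range by (intro nn_integral_cong_AE) (auto simp: fibre_measure_Omega)
  finally show "emeasure lam_mu (space lam_mu) = 1"
    using sine.emeasure_space_1 by simp
qed

interpretation lm: prob_space lam_mu
  by (rule prob_space_lam_mu)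

section \<open>Branches of the skew map\<close>

context small_angle
begin

abbreviation "S \<equiv> S_map \<alpha>"
abbreviation "J \<equiv> J_set \<alpha>"

definition psum :: "nat \<Rightarrow> real \<Rightarrow> real" where
  "psum k x = (\<Sum>i = 1..<k. p i x)"

lemma psum_simps: "psum 1 x = 0" "psum 2 x = p 1 x" "psum 3 x = p 1 x + p 2 x"
  "psum 4 x = p 1 x + p 2 x + p 3 x"
  by (simp_all add: psum_def eval_nat_numeral)

lemma psum_measurable [measurable]: "psum k \<in> borel_measurable borel"
  unfolding psum_def by measurable

lemma J_iff:
  assumes "k \<in> {1..4}"
  shows "(y, x) \<in> J k \<longleftrightarrow> (y, x) \<in> Omega \<and> psum k x \<le> y \<and> y < psum k x + p k x"
proof -
  have "(\<Sum>i = 1..k. p i x) = psum k x + p k x"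
    using assms sum.last_plus[of 1 k "\<lambda>i. p i x"] by (simp add: psum_def add.commute atLeastLessThanSuc_atLeastAtMost)
  then show ?thesis by (auto simp: J_set_def psum_def)
qed

lemma psum_range:
  assumes "k \<in> {1..4}" "0 \<le> x" "x \<le> pi"
  shows "0 \<le> psum k x" "psum k x + p k x \<le> 1"
  using assms(1) sum_p[OF assms(2,3), unfolded sum_1_4] p_nonneg[OF _ assms(2,3), of 1] p_nonneg[OF _ assms(2,3), of 2]
    p_nonneg[OF _ assms(2,3), of 3] p_nonneg[OF _ assms(2,3), of 4]
  by (cases rule: index_cases; simp add: psum_simps del: One_nat_def)+

lemma J_subset: "J k \<subseteq> Omega"
  by (auto simp: J_set_def)

lemma J_disjoint:
  assumes "\<omega> \<in> J k" "\<omega> \<in> J l" "k \<in> {1..4}" "l \<in> {1..4}"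
  shows "k = l"
proof -
  obtain y x where \<omega>: "\<omega> = (y, x)" by fastforce
  then have "0 \<le> x" "x \<le> pi" using assms(1) J_subset[of k] by (auto simp: Omega_def)
  note nn = p_nonneg[OF _ this]
  show ?thesis
    using assms(1,2) nn[of 1] nn[of 2] nn[of 3] nn[of 4]
    unfolding \<omega> J_iff[OF assms(3)] J_iff[OF assms(4)]
    by - (rule index_cases[OF assms(3)]; rule index_cases[OF assms(4)]; simp add: psum_simps del: One_nat_def)
qed

lemma J_cover:
  assumes "\<omega> \<in> Omega"
  obtains k where "k \<in> {1..4}" "\<omega> \<in> J k"
proof -
  obtain y x where \<omega>: "\<omega> = (y, x)" by fastforce
  then have x: "0 \<le> x" "x \<le> pi" "0 \<le> y" "y < 1" using assms by (auto simp: Omega_def)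
  have "(y, x) \<in> J 1 \<or> (y, x) \<in> J 2 \<or> (y, x) \<in> J 3 \<or> (y, x) \<in> J 4"
    using assms[unfolded \<omega>] x sum_p[OF x(1,2), unfolded sum_1_4]
    by (simp add: J_iff psum_simps del: One_nat_def) linarith
  then have "\<exists>k\<in>{1..4}. \<omega> \<in> J k" unfolding atLeast1_atMost4 \<omega> by blast
  then show ?thesis using that by blast
qed

lemma UN_J: "(\<Union>k\<in>{1..4}. J k) = Omega"
proof (intro equalityI subsetI)
  fix \<omega> assume "\<omega> \<in> Omega"
  then obtain k where "k \<in> {1..4}" "\<omega> \<in> J k" by (rule J_cover)
  then show "\<omega> \<in> (\<Union>k\<in>{1..4}. J k)" by blast
qed (use J_subset in blast)

lemma J_index_eq:
  assumes "\<omega> \<in> J k" "k \<in> {1..4}"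
  shows "J_index \<alpha> \<omega> = k"
  unfolding J_index_def using assms J_disjoint by blast

lemma S_on_J:
  assumes "(y, x) \<in> J k" "k \<in> {1..4}"
  shows "S (y, x) = ((y - psum k x) / p k x, \<tau> k x)"
  using J_index_eq[OF assms] by (simp add: S_map_def Let_def psum_def)

text \<open>Inverse of \<open>S\<close> on \<open>J k\<close>: the base point is found by inverting
  \<open>\<tau> k\<close>, and the fibre \<open>[0, 1)\<close> is squeezed into the interval of
  length \<open>p k x'\<close> that starts at \<open>psum k x'\<close>.\<close>

definition branch_inverse :: "nat \<Rightarrow> real \<times> real \<Rightarrow> real \<times> real" where
  "branch_inverse k = (\<lambda>(z, x). let x' = \<tau> (reverse_branch k) x in (psum k x' + p k x' * z, x'))"

text \<open>The image of \<open>J k\<close> under \<open>S\<close>. For points of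
  \<open>Omega\<close>, membership depends on the second coordinate only, so it consists of full
  fibres.\<close>

definition branch_range :: "nat \<Rightarrow> (real \<times> real) set" where
  "branch_range k = {\<omega> \<in> Omega. 0 \<le> \<tau> (reverse_branch k) (snd \<omega>) \<and> \<tau> (reverse_branch k) (snd \<omega>) \<le> pi \<and> p k (\<tau> (reverse_branch k) (snd \<omega>)) > 0}"

lemma fst_borel [measurable]: "fst \<in> borel_measurable (borel :: (real \<times> real) measure)"
  and snd_borel [measurable]: "snd \<in> borel_measurable (borel :: (real \<times> real) measure)"
  by (intro borel_measurable_continuous_onI continuous_intros)+

lemma branch_inverse_measurable: "branch_inverse k \<in> borel_measurable borel"
proof -
  have "branch_inverse k = (\<lambda>\<omega>. (psum k (\<tau> (reverse_branch k) (snd \<omega>)) + p k (\<tau> (reverse_branch k) (snd \<omega>)) * fst \<omega>, \<tau> (reverse_branch k) (snd \<omega>)))"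
    by (simp add: branch_inverse_def Let_def fun_eq_iff)
  also have "\<dots> \<in> borel_measurable borel"
    by (intro borel_measurable_Pair) measurable
  finally show ?thesis .
qed

lemma branch_range_borel: "branch_range k \<in> sets borel"
  unfolding branch_range_def by measurable

lemma branch_inverse_S:
  assumes "\<omega> \<in> J k" "k \<in> {1..4}"
  shows "S \<omega> \<in> branch_range k" "branch_inverse k (S \<omega>) = \<omega>" "S \<omega> \<in> Omega" "snd (S \<omega>) = \<tau> k (snd \<omega>)"
proof -
  obtain y x where \<omega>: "\<omega> = (y, x)" by fastforce
  note S = S_on_J[OF assms(1)[unfolded \<omega>] assms(2)]
  have *: "0 \<le> x" "x \<le> pi" "psum k x \<le> y" "y < psum k x + p k x"
    using assms(1) unfolding \<omega> J_iff[OF assms(2)] by (auto simp: Omega_def)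
  then have p: "p k x > 0" by linarith
  note t = tau_range[OF assms(2) *(1,2) p]
  show 1: "S \<omega> \<in> Omega"
    using * p t unfolding \<omega> S by (simp add: Omega_def field_simps)
  show "S \<omega> \<in> branch_range k"
    using 1 * p unfolding branch_range_def by (simp add: \<omega> S)
  show "branch_inverse k (S \<omega>) = \<omega>"
    using p by (simp add: \<omega> S branch_inverse_def Let_def)
  show "snd (S \<omega>) = \<tau> k (snd \<omega>)"
    by (simp add: \<omega> S)
qed

lemma S_branch_inverse:
  assumes "\<omega> \<in> branch_range k" "k \<in> {1..4}"
  shows "branch_inverse k \<omega> \<in> J k" "S (branch_inverse k \<omega>) = \<omega>"
proof -
  obtain z x where \<omega>: "\<omega> = (z, x)" by fastforce
  define x' where "x' = \<tau> (reverse_branch k) x"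
  have *: "0 \<le> x'" "x' \<le> pi" "p k x' > 0" "0 \<le> z" "z < 1"
    using assms(1) by (auto simp: \<omega> branch_range_def x'_def Omega_def)
  have R: "branch_inverse k \<omega> = (psum k x' + p k x' * z, x')"
    by (simp add: branch_inverse_def \<omega> x'_def Let_def)
  have lt: "p k x' * z < p k x'" "0 \<le> p k x' * z" using * by simp_all
  then have "psum k x' + p k x' * z < 1" "0 \<le> psum k x' + p k x' * z"
    using psum_range[OF assms(2) *(1,2)] by linarith+
  then show 1: "branch_inverse k \<omega> \<in> J k"
    using lt * unfolding R J_iff[OF assms(2)] Omega_def by simp
  show "S (branch_inverse k \<omega>) = \<omega>"
    unfolding R S_on_J[OF 1[unfolded R] assms(2)] using * by (simp add: \<omega> x'_def)
qed

lemma S_Omega: "\<omega> \<in> Omega \<Longrightarrow> S \<omega> \<in> Omega"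
  by (rule J_cover[of \<omega>]) (auto intro: branch_inverse_S)

lemma J_borel [measurable]: "k \<in> {1..4} \<Longrightarrow> J k \<in> sets borel"
proof -
  assume k: "k \<in> {1..4}"
  have "J k = {\<omega> \<in> Omega. psum k (snd \<omega>) \<le> fst \<omega> \<and> fst \<omega> < psum k (snd \<omega>) + p k (snd \<omega>)}"
    using J_iff[OF k] by auto
  also have "\<dots> \<in> sets borel" by measurable
  finally show ?thesis .
qed

lemma S_image_J:
  assumes "k \<in> {1..4}"
  shows "S ` (A \<inter> J k) = branch_inverse k -` A \<inter> branch_range k"
proof (intro equalityI subsetI)
  fix \<omega> assume "\<omega> \<in> branch_inverse k -` A \<inter> branch_range k"
  then show "\<omega> \<in> S ` (A \<inter> J k)"
    using S_branch_inverse[of \<omega> k] assms by (intro image_eqI[of _ _ "branch_inverse k \<omega>"]) auto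
qed (use branch_inverse_S[OF _ assms] in auto)

text \<open>Images of Borel sets need not be Borel in general. Here \<open>S\<close> is injective on
  each of four pieces with a Borel inverse, so the image is a finite union of Borel
  preimages.\<close>

lemma S_image_sets:
  assumes "A \<in> sets lam_mu"
  shows "S ` A \<in> sets lam_mu"
proof -
  have "A = (\<Union>k\<in>{1..4}. A \<inter> J k)"
    using assms UN_J by (auto simp: sets_lam_mu)
  then have "S ` A = (\<Union>k\<in>{1..4}. S ` (A \<inter> J k))"
    by (metis image_UN)
  also have "\<dots> = (\<Union>k\<in>{1..4}. branch_inverse k -` A \<inter> branch_range k)"
    using S_image_J by auto
  also have "\<dots> \<in> sets borel"
    using measurable_sets[OF branch_inverse_measurable, of A] assms branch_range_borel
    by (intro sets.finite_UN) (auto simp: sets_lam_mu)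
  finally have "S ` A \<in> sets borel" .
  moreover have "S ` A \<subseteq> Omega"
    using assms S_Omega by (auto simp: sets_lam_mu)
  ultimately show ?thesis by (simp add: sets_lam_mu)
qed

lemma S_pow_image_sets:
  "A \<in> sets lam_mu \<Longrightarrow> (S ^^ n) ` A \<in> sets lam_mu"
proof (induction n)
  case (Suc n)
  then show ?case using S_image_sets[of "(S ^^ n) ` A"] by (simp add: image_comp)
qed simp

lemma S_vimage_decomp:
  "S -` B \<inter> Omega = (\<Union>k\<in>{1..4}. J k \<inter> S -` B)"
  using UN_J by blast

lemma J_S_vimage_sets:
  assumes "B \<in> sets lam_mu" "k \<in> {1..4}"
  shows "J k \<inter> S -` B \<in> sets lam_mu"
proof -
  define f where "f \<omega> = ((fst \<omega> - psum k (snd \<omega>)) / p k (snd \<omega>), \<tau> k (snd \<omega>))" for \<omega> :: "real \<times> real"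
  have "f \<in> borel_measurable borel"
    unfolding f_def by (intro borel_measurable_Pair) measurable
  from measurable_sets[OF this, of B] have "J k \<inter> f -` B \<in> sets borel"
    using assms J_borel by (auto simp: sets_lam_mu)
  moreover have "J k \<inter> S -` B = J k \<inter> f -` B"
    using S_on_J[OF _ assms(2)] by (auto simp: f_def)
  ultimately show ?thesis
    using J_subset by (auto simp: sets_lam_mu)
qed

lemma S_vimage_sets:
  assumes "B \<in> sets lam_mu"
  shows "S -` B \<inter> Omega \<in> sets lam_mu"
  unfolding S_vimage_decomp using J_S_vimage_sets[OF assms]
  by (intro sets.finite_UN) auto

lemma S_measurable: "S \<in> measurable lam_mu lam_mu"
  using S_vimage_sets S_Omega by (intro measurableI) auto

lemma S_pow_measurable: "S ^^ n \<in> measurable lam_mu lam_mu"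
proof (induction n)
  case (Suc n)
  then show ?case
    using measurable_comp[OF Suc S_measurable] by (simp add: o_def)
qed simp

section \<open>The transition operator on fibres\<close>

lemma measure_affine_preimage:
  fixes Z :: "real set"
  assumes "c > 0" and [measurable]: "Z \<in> sets borel"
  shows "measure lborel {y. (y - a) / c \<in> Z} = c * measure lborel Z"
proof -
  have "measure lborel {y. (y - a) / c \<in> Z} = (\<integral>y. indicator {y. (y - a) / c \<in> Z} y \<partial>lborel)"
    by simp
  also have "\<dots> = c * (\<integral>z. indicator {y. (y - a) / c \<in> Z} (a + c * z) \<partial>lborel)"
    using assms(1) by (subst lborel_integral_real_affine[of c _ a]) auto
  also have "(\<lambda>z. indicator {y. (y - a) / c \<in> Z} (a + c * z)) = (indicator Z :: real \<Rightarrow> real)"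
    using assms(1) by (auto simp: indicator_def)
  finally show ?thesis by simp
qed

text \<open>Over \<open>x\<close> the set \<open>J k\<close> is an interval of length
  \<open>p k x\<close>, which \<open>S\<close> stretches affinely onto the full fibre over
  \<open>\<tau> k x\<close>. If \<open>p k x\<close> is zero, the division is meaningless but the
  interval is empty.\<close>

lemma fibre_measure_J:
  assumes "B \<in> sets lam_mu" "k \<in> {1..4}" "0 \<le> x" "x \<le> pi"
  shows "fibre_measure (J k \<inter> S -` B) x = p k x * fibre_measure B (\<tau> k x)"
proof (cases "p k x = 0")
  case True
  then have *: "{y. (y, x) \<in> J k \<inter> S -` B} = {}"
    using J_iff[OF assms(2)] by auto
  show ?thesis unfolding fibre_measure_def * by (simp add: True)
next
  case False
  then have p: "p k x > 0" using p_nonneg[OF assms(2-4)] by simp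
  have "(y, x) \<in> J k \<inter> S -` B \<longleftrightarrow> ((y - psum k x) / p k x, \<tau> k x) \<in> B" for y
  proof
    assume "(y, x) \<in> J k \<inter> S -` B"
    then show "((y - psum k x) / p k x, \<tau> k x) \<in> B"
      using S_on_J[OF _ assms(2), of y x] by auto
  next
    assume *: "((y - psum k x) / p k x, \<tau> k x) \<in> B"
    then have "((y - psum k x) / p k x, \<tau> k x) \<in> Omega"
      using assms(1) by (auto simp: sets_lam_mu)
    then have y: "psum k x \<le> y" "y < psum k x + p k x"
      using p by (auto simp: Omega_def zero_le_divide_iff field_simps)
    then have "(y, x) \<in> J k"
      using psum_range[OF assms(2-4)] assms(3,4) by (auto simp: J_iff[OF assms(2)] Omega_def)
    then show "(y, x) \<in> J k \<inter> S -` B"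
      using * S_on_J[OF _ assms(2), of y x] by auto
  qed
  then have "{y. (y, x) \<in> J k \<inter> S -` B} = {y. (y - psum k x) / p k x \<in> {z. (z, \<tau> k x) \<in> B}}"
    by auto
  then show ?thesis
    using assms(1) measure_affine_preimage[OF p fibre_set_borel[of B "\<tau> k x"]]
    by (simp add: fibre_measure_def sets_lam_mu)
qed

definition Q :: "(real \<Rightarrow> real) \<Rightarrow> real \<Rightarrow> real" where
  "Q f x = (\<Sum>k = 1..4. p k x * f (\<tau> k x))"

lemma fibre_measure_vimage:
  assumes "B \<in> sets lam_mu" "0 \<le> x" "x \<le> pi"
  shows "fibre_measure (S -` B \<inter> Omega) x = Q (fibre_measure B) x"
proof -
  have "{y. (y, x) \<in> S -` B \<inter> Omega} = (\<Union>k\<in>{1..4}. {y. (y, x) \<in> J k \<inter> S -` B})"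
    unfolding S_vimage_decomp by auto
  also have "measure lborel \<dots> = (\<Sum>k = 1..4. fibre_measure (J k \<inter> S -` B) x)"
    unfolding fibre_measure_def
  proof (rule measure_finite_Union)
    show "disjoint_family_on (\<lambda>k. {y. (y, x) \<in> J k \<inter> S -` B}) {1..4}"
      unfolding disjoint_family_on_def using J_disjoint by blast
    show "(\<lambda>k. {y. (y, x) \<in> J k \<inter> S -` B}) ` {1..4} \<subseteq> sets lborel"
      using fmeasurable_fibre[OF J_S_vimage_sets[OF assms(1)]] by blast
    show "emeasure lborel {y. (y, x) \<in> J k \<inter> S -` B} \<noteq> \<infinity>" if "k \<in> {1..4}" for k
      using fmeasurableD2[OF fmeasurable_fibre[OF J_S_vimage_sets[OF assms(1) that]]] by simp
  qed simp
  finally show ?thesis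
    using fibre_measure_J[OF assms(1) _ assms(2,3)] by (simp add: Q_def fibre_measure_def)
qed

end

section \<open>Reversibility and backward sequences\<close>

text \<open>Fibre measures belong to this class. The bounds are asked for everywhere, since
  \<open>\<tau> k x\<close> may leave \<open>[0, pi]\<close> where \<open>p k x\<close>
  vanishes.\<close>

definition unit_fun :: "(real \<Rightarrow> real) \<Rightarrow> bool" where
  "unit_fun f \<longleftrightarrow> f \<in> borel_measurable borel \<and> (\<forall>x. 0 \<le> f x \<and> f x \<le> 1)"

lemma unit_fun_measurable [measurable_dest]: "unit_fun f \<Longrightarrow> f \<in> borel_measurable borel"
  by (simp add: unit_fun_def)

lemma unit_funD: "unit_fun f \<Longrightarrow> 0 \<le> f x" "unit_fun f \<Longrightarrow> f x \<le> 1"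
  by (simp_all add: unit_fun_def)

lemma unit_fun_mult: "unit_fun f \<Longrightarrow> unit_fun g \<Longrightarrow> unit_fun (\<lambda>x. f x * g x)"
  by (auto simp: unit_fun_def intro!: mult_le_one)

lemma integrable_unit_fun: "unit_fun f \<Longrightarrow> integrable sine_measure f"
  by (rule integrable_bounded[where K = 1]) (auto simp: unit_fun_def)

lemma integral_sine_measure:
  assumes [measurable]: "f \<in> borel_measurable borel"
  shows "(\<integral>x. f x \<partial>sine_measure) = (\<integral>x. indicator {0..pi} x * (sin x / 2) * f x \<partial>lborel)"
  unfolding sine_measure_def using sine_density_nonneg
  by (subst integral_real_density) auto

text \<open>Young's inequality at scale \<open>e\<close>. Integrated over a probability space, it
  makes an L1 norm small once the L2 norm is small.\<close>

lemma young_half: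
  fixes e t :: real
  assumes "e > 0"
  shows "t \<le> e / 2 + t\<^sup>2 / (2 * e)"
proof -
  have "e / 2 + t\<^sup>2 / (2 * e) - t = (t - e)\<^sup>2 / (2 * e)"
    using assms by (simp add: field_simps power2_eq_square)
  moreover have "0 \<le> (t - e)\<^sup>2 / (2 * e)" using assms by simp
  ultimately show ?thesis by linarith
qed

context small_angle
begin

text \<open>Each branch is affine of slope 1 or -1 and so preserves Lebesgue measure; after the
  substitution, detailed balance moves the weight to the reverse branch.\<close>

lemma integral_branch:
  assumes [measurable]: "F \<in> borel_measurable borel" and k: "k \<in> {1..4}"
  shows "(\<integral>x. p k x * F x \<partial>sine_measure) = (\<integral>x. p (reverse_branch k) x * F (\<tau> (reverse_branch k) x) \<partial>sine_measure)"
proof -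
  have w: "(\<integral>x. p j x * G x \<partial>sine_measure) = (\<integral>x. weight \<alpha> j x * G x / 2 \<partial>lborel)"
    if [measurable]: "G \<in> borel_measurable borel" for G j
    by (subst integral_sine_measure) (auto simp: weight_def indicator_def intro!: Bochner_Integration.integral_cong)
  obtain c t where c: "\<bar>c\<bar> = 1" and ct: "\<tau> (reverse_branch k) x = t + c * x" for x
  proof (cases "k = 1 \<or> k = 3")
    case True
    then show ?thesis by (intro that[of 1 "\<tau> (reverse_branch k) 0"]) (auto simp: tau_def reverse_branch_def)
  next
    case False
    then show ?thesis by (intro that[of "-1" "\<tau> (reverse_branch k) 0"]) (auto simp: tau_def reverse_branch_def)
  qed
  have "(\<integral>x. p k x * F x \<partial>sine_measure) = (\<integral>x. weight \<alpha> k x * F x / 2 \<partial>lborel)"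
    by (rule w) fact
  also have "\<dots> = (\<integral>x. weight \<alpha> k (\<tau> (reverse_branch k) x) * F (\<tau> (reverse_branch k) x) / 2 \<partial>lborel)"
    using c unfolding ct by (subst lborel_integral_real_affine[of c _ t]) auto
  also have "\<dots> = (\<integral>x. weight \<alpha> (reverse_branch k) x * F (\<tau> (reverse_branch k) x) / 2 \<partial>lborel)"
    using detailed_balance[OF reverse_branch_in[OF k]] by simp
  also have "\<dots> = (\<integral>x. p (reverse_branch k) x * F (\<tau> (reverse_branch k) x) \<partial>sine_measure)"
    by (rule w[symmetric]) measurable
  finally show ?thesis .
qed

lemma integrable_branch:
  assumes "f \<in> borel_measurable borel" "\<And>x. \<bar>f x\<bar> \<le> K" "k \<in> {1..4}"
  shows "integrable sine_measure (\<lambda>x. p k x * f x)"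
proof (rule integrable_bounded[where K = K])
  show "(\<lambda>x. p k x * f x) \<in> borel_measurable borel" using assms(1) by measurable
  fix x assume "0 < x" "x < pi"
  then have "0 \<le> p k x" "p k x \<le> 1" using p_nonneg p_le_1 assms(3) by auto
  then have "\<bar>p k x\<bar> * \<bar>f x\<bar> \<le> 1 * \<bar>f x\<bar>" by (intro mult_right_mono) auto
  then show "\<bar>p k x * f x\<bar> \<le> K" using assms(2)[of x] by (simp add: abs_mult)
qed

text \<open>Branchwise substitution turns \<open>f (\<tau> k x) * g x\<close> into
  \<open>f x * g (\<tau> (reverse_branch k) x)\<close>, and the sum over all branches absorbs the
  reversal.\<close>

lemma Q_symmetric:
  assumes f: "unit_fun f" and g: "unit_fun g"
  shows "(\<integral>x. Q f x * g x \<partial>sine_measure) = (\<integral>x. f x * Q g x \<partial>sine_measure)"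
proof -
  have [measurable]: "f \<in> borel_measurable borel" "g \<in> borel_measurable borel"
    using f g by auto
  have bd: "\<bar>f x * g y\<bar> \<le> 1" for x y
    using f g by (auto simp: unit_fun_def abs_mult intro!: mult_le_one)
  have int: "integrable sine_measure (\<lambda>x. p k x * (f (\<tau> k x) * g x))"
       "integrable sine_measure (\<lambda>x. p k x * (f x * g (\<tau> k x)))" if "k \<in> {1..4}" for k
    using that bd by (auto intro!: integrable_branch[where K = 1])
  have "(\<integral>x. Q f x * g x \<partial>sine_measure) = (\<integral>x. (\<Sum>k = 1..4. p k x * (f (\<tau> k x) * g x)) \<partial>sine_measure)"
    by (simp add: Q_def sum_distrib_right mult.assoc)
  also have "\<dots> = (\<Sum>k = 1..4. \<integral>x. p k x * (f (\<tau> k x) * g x) \<partial>sine_measure)"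
    using int by (intro Bochner_Integration.integral_sum) auto
  also have "\<dots> = (\<Sum>k = 1..4. \<integral>x. p (reverse_branch k) x * (f x * g (\<tau> (reverse_branch k) x)) \<partial>sine_measure)"
    by (intro sum.cong refl) (subst integral_branch, auto)
  also have "\<dots> = (\<Sum>k = 1..4. \<integral>x. p k x * (f x * g (\<tau> k x)) \<partial>sine_measure)"
    by (rule sum.reindex_bij_witness[of _ reverse_branch reverse_branch]) (use reverse_branch_in in auto)
  also have "\<dots> = (\<integral>x. (\<Sum>k = 1..4. p k x * (f x * g (\<tau> k x))) \<partial>sine_measure)"
    using int by (intro Bochner_Integration.integral_sum[symmetric]) auto
  also have "\<dots> = (\<integral>x. f x * Q g x \<partial>sine_measure)"
    by (simp add: Q_def sum_distrib_left mult_ac)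
  finally show ?thesis .
qed

lemma Q_measurable [measurable (raw)]: "f \<in> borel_measurable borel \<Longrightarrow> Q f \<in> borel_measurable borel"
proof -
  assume [measurable]: "f \<in> borel_measurable borel"
  show ?thesis unfolding Q_def by measurable
qed

lemma Q_const: "0 \<le> x \<Longrightarrow> x \<le> pi \<Longrightarrow> Q (\<lambda>_. c) x = c"
  using sum_p[of x] by (simp add: Q_def flip: sum_distrib_right)

lemma AE_sine_measureI: "(\<And>x. 0 < x \<Longrightarrow> x < pi \<Longrightarrow> P x) \<Longrightarrow> AE x in sine_measure. P x"
  unfolding AE_sine_measure_iff by simp

lemma integral_sine_cong:
  fixes f g :: "real \<Rightarrow> real"
  assumes "f \<in> borel_measurable borel" "g \<in> borel_measurable borel" "\<And>x. 0 < x \<Longrightarrow> x < pi \<Longrightarrow> f x = g x"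
  shows "(\<integral>x. f x \<partial>sine_measure) = (\<integral>x. g x \<partial>sine_measure)"
  using assms by (intro integral_cong_AE AE_sine_measureI) auto

text \<open>Symmetry tested against the constant 1, which \<open>Q\<close> fixes on
  \<open>[0, pi]\<close>.\<close>

lemma integral_Q:
  assumes f: "unit_fun f"
  shows "(\<integral>x. Q f x \<partial>sine_measure) = (\<integral>x. f x \<partial>sine_measure)"
proof -
  have [measurable]: "f \<in> borel_measurable borel" using f by auto
  have "unit_fun (\<lambda>_. 1)" by (simp add: unit_fun_def)
  from Q_symmetric[OF f this] have "(\<integral>x. Q f x \<partial>sine_measure) = (\<integral>x. f x * Q (\<lambda>_. 1) x \<partial>sine_measure)"
    by simp
  also have "\<dots> = (\<integral>x. f x \<partial>sine_measure)"
    by (rule integral_sine_cong) (auto simp: Q_const)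
  finally show ?thesis .
qed

end

text \<open>The functions \<open>\<phi> n\<close> are the conditional probabilities \<open>x \<mapsto> \<lambda> {y. (y, x) \<in> C n}\<close>
  of a sequence of events with \<open>C n = S -` C (Suc n)\<close>.\<close>

locale backward_sequence = small_angle +
  fixes \<phi> :: "nat \<Rightarrow> real \<Rightarrow> real"
  assumes unit: "unit_fun (\<phi> n)"
    and backward: "0 \<le> x \<Longrightarrow> x \<le> pi \<Longrightarrow> \<phi> n x = Q (\<phi> (Suc n)) x"
begin

lemma phi_measurable [measurable]: "\<phi> n \<in> borel_measurable borel"
  using unit by auto

definition corr :: "nat \<Rightarrow> real" where
  "corr j = (\<integral>x. \<phi> j x * \<phi> 0 x \<partial>sine_measure)"

text \<open>One use of the symmetry of \<open>Q\<close> raises \<open>n\<close> and lowers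
  \<open>m\<close> by one; repetition brings \<open>m\<close> to 0.\<close>

lemma integral_phi_mult: "(\<integral>x. \<phi> n x * \<phi> m x \<partial>sine_measure) = corr (n + m)"
proof (induction m arbitrary: n)
  case (Suc m)
  have "(\<integral>x. \<phi> n x * \<phi> (Suc m) x \<partial>sine_measure) = (\<integral>x. Q (\<phi> (Suc n)) x * \<phi> (Suc m) x \<partial>sine_measure)"
    by (rule integral_sine_cong) (auto simp: backward)
  also have "\<dots> = (\<integral>x. \<phi> (Suc n) x * Q (\<phi> (Suc m)) x \<partial>sine_measure)"
    by (rule Q_symmetric) (rule unit)+
  also have "\<dots> = (\<integral>x. \<phi> (Suc n) x * \<phi> m x \<partial>sine_measure)"
    by (rule integral_sine_cong) (auto simp: backward)
  finally show ?case by (simp add: Suc.IH)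
qed (simp add: corr_def)

lemma integrable_phi_mult: "integrable sine_measure (\<lambda>x. \<phi> n x * \<phi> m x)"
  by (intro integrable_unit_fun unit_fun_mult unit)

lemma corr_le_1: "corr n \<le> 1"
proof -
  have "corr n \<le> (\<integral>x. 1 \<partial>sine_measure)"
    unfolding corr_def
    by (intro integral_mono integrable_phi_mult) (use unit_funD[OF unit_fun_mult[OF unit unit]] in auto)
  then show ?thesis using sine.prob_space by simp
qed

text \<open>For even \<open>n\<close> and \<open>m\<close> all three indices on the right are even,
  so convergence of \<open>corr\<close> along the even numbers controls these distances.\<close>

lemma integral_phi_diff: "(\<integral>x. (\<phi> n x - \<phi> m x)\<^sup>2 \<partial>sine_measure) = corr (2 * n) + corr (2 * m) - 2 * corr (n + m)"
proof -
  have "(\<integral>x. (\<phi> n x - \<phi> m x)\<^sup>2 \<partial>sine_measure) =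
      (\<integral>x. \<phi> n x * \<phi> n x + \<phi> m x * \<phi> m x - 2 * (\<phi> n x * \<phi> m x) \<partial>sine_measure)"
    by (simp add: power2_eq_square algebra_simps)
  also have "\<dots> = (\<integral>x. \<phi> n x * \<phi> n x \<partial>sine_measure) + (\<integral>x. \<phi> m x * \<phi> m x \<partial>sine_measure)
      - 2 * (\<integral>x. \<phi> n x * \<phi> m x \<partial>sine_measure)"
    using integrable_phi_mult by simp
  finally show ?thesis by (simp add: integral_phi_mult flip: mult_2)
qed

text \<open>The conditional variance of \<open>\<phi> (Suc n)\<close> one step after
  \<open>x\<close>: by \<open>backward\<close> the conditional mean is
  \<open>\<phi> n x\<close>.\<close>

definition increment :: "nat \<Rightarrow> real \<Rightarrow> real" where
  "increment n x = (\<Sum>k = 1..4. p k x * (\<phi> (Suc n) (\<tau> k x) - \<phi> n x)\<^sup>2)"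

lemma increment_eq:
  assumes "0 \<le> x" "x \<le> pi"
  shows "increment n x = Q (\<lambda>x. \<phi> (Suc n) x * \<phi> (Suc n) x) x - \<phi> n x * \<phi> n x"
proof -
  define v where "v = \<phi> n x"
  have "increment n x = (\<Sum>k = 1..4. p k x * (\<phi> (Suc n) (\<tau> k x) * \<phi> (Suc n) (\<tau> k x)))
      - 2 * v * (\<Sum>k = 1..4. p k x * \<phi> (Suc n) (\<tau> k x)) + v * v * (\<Sum>k = 1..4. p k x)"
    unfolding increment_def sum_distrib_left sum_subtractf[symmetric] sum.distrib[symmetric]
    by (intro sum.cong refl) (simp add: v_def power2_eq_square algebra_simps)
  then show ?thesis
    using backward[OF assms, of n] sum_p[OF assms] by (simp add: Q_def v_def)
qed

lemma increment_nonneg: "0 \<le> x \<Longrightarrow> x \<le> pi \<Longrightarrow> 0 \<le> increment n x"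
  unfolding increment_def by (auto intro!: sum_nonneg mult_nonneg_nonneg p_nonneg)

lemma increment_measurable [measurable]: "increment n \<in> borel_measurable borel"
  unfolding increment_def by measurable

lemma increment_le_1:
  assumes "0 \<le> x" "x \<le> pi" shows "increment n x \<le> 1"
proof -
  have "Q (\<lambda>x. \<phi> (Suc n) x * \<phi> (Suc n) x) x \<le> Q (\<lambda>_. 1) x"
    unfolding Q_def using unit_funD[OF unit_fun_mult[OF unit unit]] p_nonneg[OF _ assms]
    by (intro sum_mono mult_left_mono) auto
  then show ?thesis
    unfolding increment_eq[OF assms] using Q_const[OF assms, of 1] zero_le_square[of "\<phi> n x"] by linarith
qed

text \<open>\<open>Q\<close> preserves the mean of the square of \<open>\<phi> (Suc n)\<close>, so
  the integrated variances telescope.\<close>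

lemma integral_increment: "(\<integral>x. increment n x \<partial>sine_measure) = corr (2 * Suc n) - corr (2 * n)"
proof -
  have u: "unit_fun (\<lambda>x. \<phi> m x * \<phi> m x)" for m by (intro unit_fun_mult unit)
  have int: "integrable sine_measure (Q (\<lambda>x. \<phi> m x * \<phi> m x))" for m
    unfolding Q_def using unit_funD[OF u]
    by (intro Bochner_Integration.integrable_sum integrable_branch[where K = 1]) auto
  have "(\<integral>x. increment n x \<partial>sine_measure) =
      (\<integral>x. Q (\<lambda>x. \<phi> (Suc n) x * \<phi> (Suc n) x) x - \<phi> n x * \<phi> n x \<partial>sine_measure)"
    by (intro integral_sine_cong) (auto simp: increment_eq)
  also have "\<dots> = (\<integral>x. Q (\<lambda>x. \<phi> (Suc n) x * \<phi> (Suc n) x) x \<partial>sine_measure) - (\<integral>x. \<phi> n x * \<phi> n x \<partial>sine_measure)"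
    using int integrable_phi_mult by (rule Bochner_Integration.integral_diff)
  finally show ?thesis
    using integral_Q[OF u] by (simp add: integral_phi_mult flip: mult_2)
qed

lemma corr_even_mono: "incseq (\<lambda>n. corr (2 * n))"
proof (rule incseq_SucI)
  fix n
  have "0 \<le> (\<integral>x. increment n x \<partial>sine_measure)"
    by (intro integral_nonneg_AE AE_sine_measureI) (simp add: increment_nonneg)
  then show "corr (2 * n) \<le> corr (2 * Suc n)"
    unfolding integral_increment by simp
qed

lemma corr_even_convergent: "convergent (\<lambda>n. corr (2 * n))"
  by (rule incseq_convergent[OF corr_even_mono, of 1]) (auto simp: corr_le_1 convergent_def)

text \<open>The integrals telescope to bounded even correlations, so the nonnegative series has a
  finite integral and is finite almost everywhere.\<close>

lemma increment_summable: "AE x in sine_measure. summable (\<lambda>n. increment n x)"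
proof -
  have int: "integrable sine_measure (increment n)" for n
    using increment_nonneg increment_le_1 by (intro integrable_bounded[where K = 1]) auto
  obtain l where "(\<lambda>n. corr (2 * n)) \<longlonglongrightarrow> l"
    using corr_even_convergent by (auto simp: convergent_def)
  then have "summable (\<lambda>n. corr (2 * Suc n) - corr (2 * n))"
    by (rule telescope_summable)
  then have "(\<Sum>n. ennreal (\<integral>x. increment n x \<partial>sine_measure)) \<noteq> \<infinity>"
    unfolding integral_increment using incseq_SucD[OF corr_even_mono]
    by (subst suminf_ennreal2) simp_all
  moreover have "(\<integral>\<^sup>+x. ennreal (increment n x) \<partial>sine_measure) = ennreal (\<integral>x. increment n x \<partial>sine_measure)" for n
    using int by (intro nn_integral_eq_integral AE_sine_measureI increment_nonneg) auto
  ultimately have "(\<integral>\<^sup>+x. (\<Sum>n. ennreal (increment n x)) \<partial>sine_measure) \<noteq> \<infinity>"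
    by (subst nn_integral_suminf) auto
  then have "AE x in sine_measure. (\<Sum>n. ennreal (increment n x)) \<noteq> \<infinity>"
    by (intro nn_integral_noteq_infinite) auto
  then show ?thesis
    using AE_sine_measure_range
  proof eventually_elim
    case (elim x)
    then show ?case by (intro summable_suminf_not_top) (auto simp: increment_nonneg)
  qed
qed

text \<open>Each edge of positive probability contributes one term of \<open>increment n x\<close>,
  and the members of a summable series tend to zero.\<close>

lemma phi_along_edges:
  "AE x in sine_measure. \<forall>k\<in>{1..4}. p k x > 0 \<longrightarrow> (\<lambda>n. \<phi> (Suc n) (\<tau> k x) - \<phi> n x) \<longlonglongrightarrow> 0"
  using increment_summable AE_sine_measure_range
proof eventually_elim
  case (elim x)
  show ?case
  proof (intro ballI impI)
    fix k :: nat assume k: "k \<in> {1..4}" and pk: "p k x > 0"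
    have "(\<lambda>n. increment n x / p k x) \<longlonglongrightarrow> 0 / p k x"
      using pk by (intro tendsto_divide tendsto_const summable_LIMSEQ_zero elim(1)) simp
    moreover have "(\<phi> (Suc n) (\<tau> k x) - \<phi> n x)\<^sup>2 \<le> increment n x / p k x" for n
    proof -
      have "p k x * (\<phi> (Suc n) (\<tau> k x) - \<phi> n x)\<^sup>2 \<le> increment n x"
        unfolding increment_def
      proof (rule member_le_sum[of k "{1..4}" "\<lambda>k. p k x * (\<phi> (Suc n) (\<tau> k x) - \<phi> n x)\<^sup>2"])
        fix j assume "j \<in> {1..4} - {k}"
        then have "0 \<le> p j x" using p_nonneg[of j x] elim(2) by simp
        then show "0 \<le> p j x * (\<phi> (Suc n) (\<tau> j x) - \<phi> n x)\<^sup>2" by simp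
      qed (use k in simp_all)
      then show ?thesis using pk by (simp add: pos_le_divide_eq mult.commute)
    qed
    ultimately have "(\<lambda>n. (\<phi> (Suc n) (\<tau> k x) - \<phi> n x)\<^sup>2) \<longlonglongrightarrow> 0"
      by (intro tendsto_sandwich[of "\<lambda>_. 0" "\<lambda>n. (\<phi> (Suc n) (\<tau> k x) - \<phi> n x)\<^sup>2" sequentially "\<lambda>n. increment n x / p k x"]
          always_eventually allI zero_le_power2 tendsto_const) simp_all
    then show "(\<lambda>n. \<phi> (Suc n) (\<tau> k x) - \<phi> n x) \<longlonglongrightarrow> 0"
      by (simp only: power_tendsto_0_iff zero_less_numeral)
  qed
qed

text \<open>Distances between even members are controlled by the convergent even correlations. The
  resulting L1 Cauchy sequence has an almost everywhere Cauchy subsequence.\<close>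

lemma phi_even_subseq:
  obtains r :: "nat \<Rightarrow> nat" where "strict_mono r" "AE x in sine_measure. Cauchy (\<lambda>i. \<phi> (2 * r i) x)"
proof -
  have *: "\<exists>N. \<forall>i\<ge>N. \<forall>j\<ge>N. (\<integral>x. norm (\<phi> (2 * i) x - \<phi> (2 * j) x) \<partial>sine_measure) < e" if "e > 0" for e :: real
  proof -
    have "Cauchy (\<lambda>n. corr (2 * n))" using corr_even_convergent by (rule convergent_Cauchy)
    from CauchyD[OF this, of "e\<^sup>2 / 2"] that
    obtain N where N: "\<And>m n. m \<ge> N \<Longrightarrow> n \<ge> N \<Longrightarrow> \<bar>corr (2 * m) - corr (2 * n)\<bar> < e\<^sup>2 / 2" by auto
    have "(\<integral>x. norm (\<phi> (2 * i) x - \<phi> (2 * j) x) \<partial>sine_measure) < e" if ij: "i \<ge> N" "j \<ge> N" for i j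
    proof -
      define d where "d x = \<phi> (2 * i) x - \<phi> (2 * j) x" for x
      have d: "\<bar>d x\<bar> \<le> 1" for x
        using unit_funD[OF unit, of "2 * i" x] unit_funD[OF unit, of "2 * j" x] by (simp add: d_def abs_le_iff)
      have [measurable]: "d \<in> borel_measurable borel" unfolding d_def by measurable
      have int: "integrable sine_measure d" "integrable sine_measure (\<lambda>x. (d x)\<^sup>2)"
        using d by (auto intro!: integrable_bounded[where K = 1] simp: abs_square_le_1)
      have "(\<integral>x. (d x)\<^sup>2 \<partial>sine_measure) = corr (2 * (2 * i)) + corr (2 * (2 * j)) - 2 * corr (2 * (i + j))"
        unfolding d_def integral_phi_diff by (simp add: algebra_simps)
      \<comment> \<open>All three arguments have the form \<open>2 * m\<close> with
        \<open>m \<ge> N\<close>, and the expression is a sum of two differences, each below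
        \<open>e\<^sup>2 / 2\<close>.\<close>
      also have "\<dots> < e\<^sup>2"
        using N[of "2 * i" "i + j"] N[of "2 * j" "i + j"] ij by linarith
      finally have sq: "(\<integral>x. (d x)\<^sup>2 \<partial>sine_measure) < e\<^sup>2" .
      have "\<bar>d x\<bar> \<le> e / 2 + (d x)\<^sup>2 / (2 * e)" for x
        using young_half[of e "\<bar>d x\<bar>"] \<open>e > 0\<close> by simp
      then have "(\<integral>x. \<bar>d x\<bar> \<partial>sine_measure) \<le> (\<integral>x. e / 2 + (d x)\<^sup>2 / (2 * e) \<partial>sine_measure)"
        using int by (intro integral_mono) auto
      also have "\<dots> = e / 2 + (\<integral>x. (d x)\<^sup>2 \<partial>sine_measure) / (2 * e)"
        using int sine.prob_space by simp
      also have "\<dots> < e / 2 + e\<^sup>2 / (2 * e)"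
        using sq \<open>e > 0\<close> by (intro add_strict_left_mono divide_strict_right_mono) auto
      also have "\<dots> = e" using \<open>e > 0\<close> by (simp add: power2_eq_square)
      finally show ?thesis by (simp add: d_def)
    qed
    then show ?thesis by blast
  qed
  show thesis
  proof (rule cauchy_L1_AE_cauchy_subseq[of sine_measure "\<lambda>n. \<phi> (2 * n)"])
    fix r :: "nat \<Rightarrow> nat"
    assume "strict_mono r" "AE x in sine_measure. Cauchy (\<lambda>i. \<phi> (2 * r i) x)"
    then show thesis by (rule that)
  qed (fact integrable_unit_fun[OF unit] *)+
qed

end

section \<open>Irrational rotations\<close>

text \<open>\<open>P\<close> is not assumed measurable, so the substitution is applied to a Borel
  null set containing the exceptional set.\<close>

lemma AE_lborel_affine:
  fixes P :: "real \<Rightarrow> bool"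
  assumes "AE x in lborel. P x" "c \<noteq> 0"
  shows "AE x in lborel. P (t + c * x)"
proof -
  obtain N where N: "{x. \<not> P x} \<subseteq> N" "N \<in> null_sets lborel"
    using assms(1) unfolding eventually_ae_filter by auto
  have [measurable]: "N \<in> sets borel" using N(2) by auto
  have "AE x in lborel. x \<notin> N" using N(2) by (rule AE_not_in)
  then have "AE x in lborel. t + c * x \<notin> N"
    by (intro AE_borel_affine[where P = "\<lambda>x. x \<notin> N"] assms(2)) measurable
  then show ?thesis using N(1) by (auto elim: eventually_mono)
qed

definition interval_mass :: "(real \<Rightarrow> real) \<Rightarrow> real \<Rightarrow> real \<Rightarrow> real" where
  "interval_mass h s t = (\<integral>x. indicator {s..<t} x * h x \<partial>lborel)"

locale bounded_density =
  fixes h :: "real \<Rightarrow> real"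
  assumes h_measurable [measurable]: "h \<in> borel_measurable borel"
    and h_nonneg: "0 \<le> h x" and h_le_1: "h x \<le> 1"
begin

abbreviation "I \<equiv> interval_mass h"

lemma integrable_indicator_ivl: "integrable lborel (indicator {s..<t} :: real \<Rightarrow> real)"
  by (cases "s \<le> t") auto

lemma integrable_window: "integrable lborel (\<lambda>x. indicator {s..<t} x * h x)"
proof (rule Bochner_Integration.integrable_bound[OF integrable_indicator_ivl[of s t]])
  show "AE x in lborel. norm (indicator {s..<t} x * h x) \<le> norm (indicator {s..<t} x :: real)"
    using h_nonneg h_le_1 by (auto simp: indicator_def)
qed measurable

lemma mass_combine: "s \<le> t \<Longrightarrow> t \<le> u \<Longrightarrow> I s u = I s t + I t u"
  unfolding interval_mass_def
  by (subst Bochner_Integration.integral_add[OF integrable_window integrable_window, symmetric])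
    (auto intro!: Bochner_Integration.integral_cong simp: indicator_def)

lemma mass_nonneg: "0 \<le> I s t"
  unfolding interval_mass_def using h_nonneg by (intro integral_nonneg_AE) auto

lemma mass_le: "s \<le> t \<Longrightarrow> I s t \<le> t - s"
proof -
  assume "s \<le> t"
  have "I s t \<le> (\<integral>x. indicator {s..<t} x \<partial>lborel)"
    unfolding interval_mass_def using h_le_1 integrable_window integrable_indicator_ivl
    by (intro integral_mono) (auto split: split_indicator)
  then show ?thesis using \<open>s \<le> t\<close> by simp
qed

lemma mass_shift:
  assumes "AE x in lborel. h (x + c) = h x"
  shows "I (s + c) (t + c) = I s t"
proof -
  have "I (s + c) (t + c) = (\<integral>x. indicator {s + c..<t + c} (c + 1 * x) * h (c + 1 * x) \<partial>lborel)"
    unfolding interval_mass_def by (subst lborel_integral_real_affine[of 1 _ c]) auto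
  also have "\<dots> = (\<integral>x. indicator {s..<t} x * h x \<partial>lborel)"
  proof (rule integral_cong_AE)
    show "AE x in lborel. indicator {s + c..<t + c} (c + 1 * x) * h (c + 1 * x) = indicator {s..<t} x * h x"
      using assms by eventually_elim (auto simp: indicator_def add.commute)
  qed measurable
  finally show ?thesis by (simp add: interval_mass_def)
qed

end

text \<open>The density \<open>(h x + 1) / (\<kappa> + 1)\<close> gives every interval its length,
  so it defines Lebesgue measure, and uniqueness of densities makes it 1 almost everywhere. Adding 1
  avoids a division by zero when \<open>\<kappa>\<close> is zero.\<close>

lemma AE_const_of_linear_mass:
  assumes "bounded_density h"
    and lin: "\<And>s t. s \<le> t \<Longrightarrow> interval_mass h s t = \<kappa> * (t - s)"
  shows "AE x in lborel. h x = \<kappa>"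
proof -
  interpret bounded_density h by fact
  have "\<kappa> \<ge> 0" using mass_nonneg[of 0 1] lin[of 0 1] by simp
  define g where "g x = ennreal ((h x + 1) / (\<kappa> + 1))" for x
  have [measurable]: "g \<in> borel_measurable borel" unfolding g_def by measurable
  have "lborel = density lborel g"
  proof (rule lborel_eqI)
    fix l u :: real
    assume "\<And>b. b \<in> Basis \<Longrightarrow> l \<bullet> b \<le> u \<bullet> b"
    then have lu: "l \<le> u" by simp
    have int: "integrable lborel (\<lambda>x. (indicator {l..<u} x * h x + indicator {l..<u} x) / (\<kappa> + 1))"
      using integrable_window integrable_indicator_ivl by simp
    have "emeasure (density lborel g) (box l u) = (\<integral>\<^sup>+x. g x * indicator (box l u) x \<partial>lborel)"
      by (subst emeasure_density) auto
    also have "\<dots> = (\<integral>\<^sup>+x. ennreal ((indicator {l..<u} x * h x + indicator {l..<u} x) / (\<kappa> + 1)) \<partial>lborel)"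
      using AE_lborel_singleton[of l] by (intro nn_integral_cong_AE) (auto elim!: eventually_mono simp: g_def indicator_def)
    also have "\<dots> = ennreal (\<integral>x. (indicator {l..<u} x * h x + indicator {l..<u} x) / (\<kappa> + 1) \<partial>lborel)"
      using h_nonneg \<open>\<kappa> \<ge> 0\<close> by (intro nn_integral_eq_integral int) (auto simp: indicator_def)
    also have "(\<integral>x. (indicator {l..<u} x * h x + indicator {l..<u} x) / (\<kappa> + 1) \<partial>lborel) = (I l u + (u - l)) / (\<kappa> + 1)"
      using integrable_window integrable_indicator_ivl lu by (simp add: interval_mass_def)
    also have "\<dots> = u - l"
      using \<open>\<kappa> \<ge> 0\<close> lu by (simp add: lin field_simps)
    finally show "emeasure (density lborel g) (box l u) = ennreal (\<Prod>b\<in>Basis. (u - l) \<bullet> b)"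
      by simp
  qed simp
  then have "density lborel (\<lambda>_. 1) = density lborel g" by (simp add: density_1)
  then have "AE x in lborel. 1 = g x"
    by (subst (asm) sigma_finite_measure.density_unique_iff[OF sigma_finite_lborel]) auto
  then show ?thesis
  proof eventually_elim
    case (elim x)
    then have "(h x + 1) / (\<kappa> + 1) = 1"
      using h_nonneg[of x] \<open>\<kappa> \<ge> 0\<close> by (metis add_nonneg_nonneg divide_nonneg_nonneg ennreal_eq_1 g_def zero_le_one)
    then show ?case using \<open>\<kappa> \<ge> 0\<close> by (simp add: field_simps)
  qed
qed

text \<open>The deviation \<open>K t = interval_mass h 0 t - \<kappa> * t\<close> of the distribution function from linearity
  is periodic, and it changes by a constant under translation by \<open>a\<close>. Boundedness makes that
  constant zero, and density of the multiples of \<open>a\<close> modulo the period makes \<open>K\<close> vanish.\<close>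

lemma irrational_rotation_ergodic:
  fixes h :: "real \<Rightarrow> real"
  assumes bd: "bounded_density h"
    and T: "T > 0" "\<And>x. h (x + T) = h x"
    and a: "a > 0" "AE x in lborel. h (x + a) = h x"
    and irr: "a / T \<notin> \<rat>"
  obtains \<kappa> where "AE x in lborel. h x = \<kappa>"
proof -
  interpret bounded_density h by fact
  define \<kappa> where "\<kappa> = I 0 T / T"
  define K where "K t = I 0 t - \<kappa> * t" for t
  have \<kappa>: "0 \<le> \<kappa>" "\<kappa> \<le> 1"
    using mass_nonneg[of 0 T] mass_le[of 0 T] T(1) by (auto simp: \<kappa>_def)
  have shift_T: "I (s + T) (t + T) = I s t" for s t
    by (rule mass_shift) (simp add: T)
  have shift_a: "I (s + a) (t + a) = I s t" for s t
    by (rule mass_shift) (rule a)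
  have K_T: "K (t + T) = K t" if "t \<ge> 0" for t
    using mass_combine[of 0 T "t + T"] shift_T[of 0 t] that T(1)
    by (simp add: K_def \<kappa>_def field_simps)
  have K_a: "K (t + a) = K t + K a" if "t \<ge> 0" for t
    using mass_combine[of 0 a "t + a"] shift_a[of 0 t] that a(1)
    by (simp add: K_def field_simps)
  have K_nT: "K (t + real n * T) = K t" if "t \<ge> 0" for t n
  proof (induction n)
    case (Suc n)
    then show ?case using K_T[of "t + real n * T"] that T(1) by (simp add: algebra_simps)
  qed simp
  have K0: "K 0 = 0" by (simp add: K_def interval_mass_def)
  have K_na: "K (real n * a) = real n * K a" for n
  proof (induction n)
    case (Suc n)
    then show ?case using K_a[of "real n * a"] a(1) by (simp add: algebra_simps)
  qed (simp add: K0)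
  have mod_T: "\<exists>n::nat. t = T * frac (t / T) + real n * T" if "t \<ge> 0" for t
    using that T(1) by (intro exI[of _ "nat \<lfloor>t / T\<rfloor>"]) (simp add: frac_def field_simps)
  have K_frac: "K t = K (T * frac (t / T))" if t: "t \<ge> 0" for t
  proof -
    from mod_T[OF t] obtain n where n: "t = T * frac (t / T) + real n * T" by blast
    have "K (T * frac (t / T) + real n * T) = K (T * frac (t / T))"
      using T(1) by (intro K_nT) simp
    then show ?thesis using n by simp
  qed
  \<comment> \<open>Both \<open>h\<close> and \<open>\<kappa>\<close> lie between 0 and 1, so the
    mass of an interval and its linear approximation both lie between 0 and its length.\<close>
  have lip: "\<bar>K t - K s\<bar> \<le> \<bar>t - s\<bar>" if "s \<ge> 0" "t \<ge> 0" for s t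
  proof -
    have *: "\<bar>K t - K s\<bar> \<le> t - s" if "0 \<le> s" "s \<le> t" for s t
    proof -
      have "K t - K s = I s t - \<kappa> * (t - s)"
        using mass_combine[OF that] by (simp add: K_def algebra_simps)
      moreover have "0 \<le> \<kappa> * (t - s)" "\<kappa> * (t - s) \<le> t - s"
        using \<kappa> that mult_right_mono[of \<kappa> 1 "t - s"] by auto
      ultimately show ?thesis using mass_nonneg[of s t] mass_le[OF that(2)] by simp
    qed
    show ?thesis using *[of s t] *[of t s] that by (cases "s \<le> t") auto
  qed
  have K_le: "\<bar>K t\<bar> \<le> T" if t: "t \<ge> 0" for t
  proof -
    have "\<bar>K (T * frac (t / T)) - K 0\<bar> \<le> \<bar>T * frac (t / T) - 0\<bar>"
      using T(1) by (intro lip) auto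
    also have "\<dots> \<le> T * 1"
      using T(1) frac_lt_1[of "t / T"] by (simp add: abs_mult)
    finally show ?thesis using K_frac[OF t] K0 by simp
  qed
  \<comment> \<open>Otherwise \<open>K (real n * a) = real n * K a\<close> would be unbounded,
    whereas \<open>K\<close> is bounded by \<open>T\<close>.\<close>
  have Ka: "K a = 0"
  proof (rule ccontr)
    assume "K a \<noteq> 0"
    then obtain n where "real n * \<bar>K a\<bar> > T"
      using reals_Archimedean3[of "\<bar>K a\<bar>"] by auto
    then show False
      using K_le[of "real n * a"] a(1) by (simp add: K_na abs_mult)
  qed
  have K_zero: "K t = 0" if t: "t \<ge> 0" for t
  proof (rule ccontr)
    assume nz: "K t \<noteq> 0"
    \<comment> \<open>Some multiple of \<open>a\<close> is so close to \<open>t\<close> modulo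
      \<open>T\<close> that the Lipschitz bound yields the absurd
      \<open>\<bar>K t\<bar> < \<bar>K t\<bar>\<close>.\<close>
    obtain k where k: "\<bar>frac (real k * (a / T)) - frac (t / T)\<bar> < \<bar>K t\<bar> / T"
      using Kronecker_approx_1_explicit[OF irr, of "frac (t / T)" "\<bar>K t\<bar> / T"] nz T(1)
        frac_lt_1[of "t / T"] by auto
    have "K (T * frac (real k * (a / T))) = 0"
      using K_frac[of "real k * a"] K_na[of k] Ka a(1) by simp
    then have "\<bar>K t\<bar> = \<bar>K (T * frac (t / T)) - K (T * frac (real k * (a / T)))\<bar>"
      using K_frac[OF t] by simp
    also have "\<dots> \<le> \<bar>T * frac (t / T) - T * frac (real k * (a / T))\<bar>"
      using T(1) by (intro lip) auto
    also have "\<dots> = T * \<bar>frac (real k * (a / T)) - frac (t / T)\<bar>"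
      using T(1) by (simp add: abs_mult abs_minus_commute flip: right_diff_distrib)
    also have "\<dots> < T * (\<bar>K t\<bar> / T)"
      using k T(1) by (rule mult_strict_left_mono)
    finally show False using T(1) by simp
  qed
  have lin0: "I s t = \<kappa> * (t - s)" if "0 \<le> s" "s \<le> t" for s t
    using mass_combine[OF that] K_zero[of s] K_zero[of t] that by (simp add: K_def algebra_simps)
  \<comment> \<open>Linearity is known for nonnegative endpoints; whole periods carry any interval
    there.\<close>
  have shift_nT: "I (s + real n * T) (t + real n * T) = I s t" for s t n
  proof (induction n)
    case (Suc n)
    then show ?case using shift_T[of "s + real n * T" "t + real n * T"] by (simp add: algebra_simps)
  qed simp
  have "I s t = \<kappa> * (t - s)" if "s \<le> t" for s t
  proof -
    obtain n where "real n * T > - s" using reals_Archimedean3[OF T(1)] by auto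
    then show ?thesis
      using lin0[of "s + real n * T" "t + real n * T"] that by (simp add: shift_nT)
  qed
  then show ?thesis
    using AE_const_of_linear_mass[OF bd] that by blast
qed

section \<open>Backward sequences are constant\<close>

text \<open>If almost every edge of the chain interchanges \<open>f\<close> and \<open>g\<close>, gluing them in this way gives a function
  on the circle that is symmetric about \<open>\<alpha>\<close> and about \<open>-\<alpha>\<close>, hence invariant under translation by \<open>4 * \<alpha>\<close>.\<close>

definition circle_fold :: "(real \<Rightarrow> real) \<Rightarrow> (real \<Rightarrow> real) \<Rightarrow> real \<Rightarrow> real" where
  "circle_fold f g t = (let s = t - 2 * pi * of_int \<lfloor>(t + pi) / (2 * pi)\<rfloor> in if s > 0 then f s else g (- s))"

lemma circle_fold_eq:
  assumes "- pi \<le> s" "s < pi" "t = s + 2 * pi * of_int l"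
  shows "circle_fold f g t = (if s > 0 then f s else g (- s))"
proof -
  have "(t + pi) / (2 * pi) = (s + pi) / (2 * pi) + of_int l"
    by (simp add: assms(3) field_simps)
  moreover have "\<lfloor>(s + pi) / (2 * pi)\<rfloor> = 0"
    using assms(1,2) by (simp add: floor_eq_iff field_simps)
  ultimately have "\<lfloor>(t + pi) / (2 * pi)\<rfloor> = l" by simp
  then show ?thesis by (simp add: circle_fold_def assms(3))
qed

lemma reduce_mod_2pi:
  obtains s :: real and l :: int where "- pi \<le> s" "s < pi" "t = s + 2 * pi * of_int l"
proof
  define u where "u = (t + pi) / (2 * pi)"
  have t: "t = 2 * pi * u - pi" by (simp add: u_def)
  have "2 * pi * of_int \<lfloor>u\<rfloor> \<le> 2 * pi * u" "2 * pi * u < 2 * pi * (of_int \<lfloor>u\<rfloor> + 1)"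
    by (intro mult_left_mono mult_strict_left_mono; simp)+
  then show "- pi \<le> t - 2 * pi * of_int \<lfloor>u\<rfloor>" "t - 2 * pi * of_int \<lfloor>u\<rfloor> < pi"
    by (simp_all add: t algebra_simps)
  show "t = (t - 2 * pi * of_int \<lfloor>u\<rfloor>) + 2 * pi * of_int \<lfloor>u\<rfloor>" by simp
qed

lemma circle_fold_periodic: "circle_fold f g (t + 2 * pi) = circle_fold f g t"
proof -
  obtain s l where s: "- pi \<le> s" "s < pi" "t = s + 2 * pi * of_int l" by (rule reduce_mod_2pi)
  have "t + 2 * pi = s + 2 * pi * of_int (l + 1)" using s(3) by (simp add: algebra_simps)
  then show ?thesis using circle_fold_eq[OF s(1,2)] s(3) by metis
qed

lemma circle_fold_measurable:
  assumes [measurable]: "f \<in> borel_measurable borel" "g \<in> borel_measurable borel"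
  shows "circle_fold f g \<in> borel_measurable borel"
  unfolding circle_fold_def Let_def by measurable

text \<open>Where the sequence diverges, \<open>lim\<close> is unspecified; clamping keeps the limit
  function between 0 and 1 everywhere, as \<open>unit_fun\<close> demands.\<close>

definition clamped_lim :: "(nat \<Rightarrow> real) \<Rightarrow> real" where
  "clamped_lim X = max 0 (min 1 (lim X))"

lemma clamped_lim_eq:
  assumes "X \<longlonglongrightarrow> L" "\<And>n. 0 \<le> X n" "\<And>n. X n \<le> 1"
  shows "clamped_lim X = L"
proof -
  have "0 \<le> L" "L \<le> 1"
    using assms by (auto intro: LIMSEQ_le_const LIMSEQ_le_const2)
  then show ?thesis using limI[OF assms(1)] by (simp add: clamped_lim_def)
qed

section \<open>Almost everywhere statements along orbits of translations and reflections\<close>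

context small_angle
begin

text \<open>\<open>P\<close> holds on the whole orbit of \<open>t\<close> under the group generated
  by the translations by \<open>2 * \<alpha>\<close> and \<open>2 * pi\<close> and the reflection in
  0. The group is countable, so a property of almost every point holds along almost every
  orbit.\<close>

definition orbitwise :: "(real \<Rightarrow> bool) \<Rightarrow> real \<Rightarrow> bool" where
  "orbitwise P t \<longleftrightarrow> (\<forall>j l::int. P (t + 2 * \<alpha> * of_int j + 2 * pi * of_int l) \<and>
                                P (- t + 2 * \<alpha> * of_int j + 2 * pi * of_int l))"

lemma AE_orbitwise:
  assumes "AE t in lborel. P t"
  shows "AE t in lborel. orbitwise P t"
proof -
  have A: "AE t in lborel. P ((2 * \<alpha> * of_int j + 2 * pi * of_int l) + c * t)" if "c \<noteq> 0" for j l :: int and c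
    using assms that by (rule AE_lborel_affine)
  have "t + 2 * \<alpha> * of_int j + 2 * pi * of_int l = (2 * \<alpha> * of_int j + 2 * pi * of_int l) + 1 * t"
    "- t + 2 * \<alpha> * of_int j + 2 * pi * of_int l = (2 * \<alpha> * of_int j + 2 * pi * of_int l) + (- 1) * t"
    for t and j l :: int by simp_all
  then show ?thesis
    unfolding orbitwise_def AE_all_countable using A[of 1] A[of "- 1"]
    by (auto simp only: intro!: AE_conjI)
qed

lemma orbitwiseD:
  assumes "orbitwise P t"
  shows "P (t + 2 * \<alpha> * of_int j + 2 * pi * of_int l)" "P (- t + 2 * \<alpha> * of_int j + 2 * pi * of_int l)"
  using assms by (auto simp: orbitwise_def)

lemma orbitwise_self: "orbitwise P t \<Longrightarrow> P t"
  using orbitwiseD(1)[of P t 0 0] by simp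

lemma orbitwise_translate:
  assumes "orbitwise P t"
  shows "orbitwise P (t + 2 * \<alpha> * of_int j + 2 * pi * of_int l)"
proof -
  have "P (t + 2 * \<alpha> * of_int (j + j') + 2 * pi * of_int (l + l'))"
    "P (- t + 2 * \<alpha> * of_int (j' - j) + 2 * pi * of_int (l' - l))" for j' l'
    by (rule orbitwiseD[OF assms])+
  then show ?thesis by (simp add: orbitwise_def algebra_simps)
qed

lemma orbitwise_minus: "orbitwise P t \<Longrightarrow> orbitwise P (- t)"
  by (auto simp: orbitwise_def)

text \<open>Every \<open>\<tau> k\<close> belongs to the group; branch 2, for instance, is the
  reflection followed by the translation with \<open>j = - 2\<close> and
  \<open>l = 1\<close>.\<close>

lemma orbitwise_tau: "orbitwise P t \<Longrightarrow> orbitwise P (\<tau> k t)"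
  using orbitwise_translate[of P t 1 0] orbitwise_translate[of P t "-1" 0]
    orbitwise_translate[OF orbitwise_minus, of P t "-2" 1] orbitwise_translate[OF orbitwise_minus, of P t 2 0]
  by (auto simp: tau_def algebra_simps)

end

text \<open>\<open>\<psi>\<close> and \<open>\<psi>'\<close> stand for limits along even and odd
  indices. Only the passage from \<open>\<psi>\<close> at \<open>x\<close> to \<open>\<psi>'\<close>
  at \<open>\<tau> k x\<close> is assumed; the other one comes from the reversed edge.\<close>

locale edge_pair = small_angle +
  fixes \<psi> \<psi>' :: "real \<Rightarrow> real" and good :: "real \<Rightarrow> bool"
  assumes edge: "\<lbrakk>good x; 0 < x; x < pi; k \<in> {1..4}; p k x > 0\<rbrakk> \<Longrightarrow> \<psi>' (\<tau> k x) = \<psi> x"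
    and AE_good: "AE x in lborel. good x"
begin

text \<open>The excluded points contain the borders between the cases in
  \<open>folded_reflect\<close>. Passing to whole orbits makes genericity stable under all
  moves.\<close>

definition generic :: "real \<Rightarrow> bool" where
  "generic t \<longleftrightarrow> orbitwise (\<lambda>x. good x \<and> x \<notin> {0, pi, - pi, 2 * \<alpha>, - 2 * \<alpha>, pi - 2 * \<alpha>, 2 * \<alpha> - pi}) t"

lemma AE_generic: "AE t in lborel. generic t"
proof -
  have "AE x in lborel. x \<notin> {0, pi, - pi, 2 * \<alpha>, - 2 * \<alpha>, pi - 2 * \<alpha>, 2 * \<alpha> - pi}"
    by (intro AE_not_in finite_imp_null_set_lborel) simp
  with AE_good have "AE x in lborel. good x \<and> x \<notin> {0, pi, - pi, 2 * \<alpha>, - 2 * \<alpha>, pi - 2 * \<alpha>, 2 * \<alpha> - pi}"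
    by eventually_elim simp
  then show ?thesis unfolding generic_def by (rule AE_orbitwise)
qed

lemma generic_good: "generic t \<Longrightarrow> good t"
  unfolding generic_def using orbitwise_self by fastforce

lemma generic_neq: "generic t \<Longrightarrow> t \<notin> {0, pi, - pi, 2 * \<alpha>, - 2 * \<alpha>, pi - 2 * \<alpha>, 2 * \<alpha> - pi}"
  unfolding generic_def using orbitwise_self by fastforce

definition swapped :: "real \<Rightarrow> real \<Rightarrow> bool" where
  "swapped x y \<longleftrightarrow> generic y \<and> \<psi>' y = \<psi> x \<and> \<psi> y = \<psi>' x"

lemma swapped_trans: "swapped x y \<Longrightarrow> swapped y z \<Longrightarrow> \<psi> z = \<psi> x \<and> \<psi>' z = \<psi>' x"
  by (simp add: swapped_def)

text \<open>By detailed balance the reversed edge has positive weight too, and \<open>edge\<close>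
  along it yields the second equation.\<close>

lemma swapped_edge:
  assumes x: "generic x" "0 < x" "x < pi" and k: "k \<in> {1..4}" and w: "weight \<alpha> k x > 0"
    and r: "0 < \<tau> k x" "\<tau> k x < pi"
  shows "swapped x (\<tau> k x)"
proof -
  have g: "generic (\<tau> k x)" using x(1) unfolding generic_def by (rule orbitwise_tau)
  have "weight \<alpha> (reverse_branch k) (\<tau> k x) > 0" using w detailed_balance[OF k] by simp
  then have "p (reverse_branch k) (\<tau> k x) > 0" using p_pos_iff[OF r] by simp
  from edge[OF generic_good[OF g] r reverse_branch_in[OF k] this] have "\<psi> (\<tau> k x) = \<psi>' x" by simp
  moreover have "\<psi>' (\<tau> k x) = \<psi> x"
    using edge[OF generic_good[OF x(1)] x(2,3) k] w p_pos_iff[OF x(2,3)] by simp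
  ultimately show ?thesis using g by (simp add: swapped_def)
qed

lemma swapped_moves:
  assumes x: "generic x" "0 < x" "x < pi"
  shows "x < pi - 2 * \<alpha> \<Longrightarrow> swapped x (x + 2 * \<alpha>)"
    "2 * \<alpha> < x \<Longrightarrow> swapped x (x - 2 * \<alpha>)"
    "\<alpha> < x \<Longrightarrow> x < 3 * \<alpha> \<Longrightarrow> swapped x (4 * \<alpha> - x)"
    "pi - 3 * \<alpha> < x \<Longrightarrow> x < pi - \<alpha> \<Longrightarrow> swapped x (2 * pi - 4 * \<alpha> - x)"
proof -
  have t: "\<tau> 1 x = x + 2 * \<alpha>" "\<tau> 3 x = x - 2 * \<alpha>" "\<tau> 4 x = 4 * \<alpha> - x"
    "\<tau> 2 x = 2 * pi - 4 * \<alpha> - x"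
    by (simp_all add: tau_def)
  note e = swapped_edge[OF x, of 1] swapped_edge[OF x, of 3] swapped_edge[OF x, of 4] swapped_edge[OF x, of 2]
  note w = weight_pos[OF x(2,3)] and a = alpha_pos alpha_less
  show "swapped x (x + 2 * \<alpha>)" if "x < pi - 2 * \<alpha>"
    using e(1) w(1) that x(2,3) a unfolding t by simp
  show "swapped x (x - 2 * \<alpha>)" if "2 * \<alpha> < x"
    using e(2) w(2) that x(2,3) a unfolding t by simp
  show "swapped x (4 * \<alpha> - x)" if "\<alpha> < x" "x < 3 * \<alpha>"
    using e(3) w(4) that x(2,3) a unfolding t by simp
  show "swapped x (2 * pi - 4 * \<alpha> - x)" if "pi - 3 * \<alpha> < x" "x < pi - \<alpha>"
    by (rule e(4)[unfolded t]) (use w(3) that x(2,3) a in auto)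
qed

text \<open>A reflection of the chain and a shift by \<open>2 * \<alpha>\<close>, composed in the
  order that keeps the path inside the interval, give the reflection in \<open>\<alpha>\<close>; the
  two swaps cancel.\<close>

lemma reflect_low:
  assumes x: "generic x" "0 < x" "x < 2 * \<alpha>"
  shows "\<psi> (2 * \<alpha> - x) = \<psi> x \<and> \<psi>' (2 * \<alpha> - x) = \<psi>' x"
proof -
  have "x < pi" using x alpha_less alpha_pos by simp
  note m = swapped_moves[OF x(1,2) this]
  consider "x < \<alpha>" | "x = \<alpha>" | "x > \<alpha>" by linarith
  then show ?thesis
  proof cases
    case 1
    then have 2: "swapped x (x + 2 * \<alpha>)" using m(1) alpha_pos alpha_less by simp
    then have "swapped (x + 2 * \<alpha>) (4 * \<alpha> - (x + 2 * \<alpha>))"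
      using 1 x alpha_less by (intro swapped_moves(3)) (auto simp: swapped_def)
    from swapped_trans[OF 2 this] show ?thesis by simp
  next
    case 3
    then have 2: "swapped x (4 * \<alpha> - x)" using m(3) x alpha_pos by simp
    then have "swapped (4 * \<alpha> - x) (4 * \<alpha> - x - 2 * \<alpha>)"
      using 3 x alpha_less by (intro swapped_moves(2)) (auto simp: swapped_def)
    from swapped_trans[OF 2 this] show ?thesis by simp
  qed simp
qed

text \<open>At the other end the same kind of two-step path, now through branch 2, gives the
  reflection in \<open>pi - \<alpha>\<close>.\<close>

lemma reflect_high:
  assumes x: "generic x" "pi - 2 * \<alpha> < x" "x < pi"
  shows "\<psi> (2 * pi - 2 * \<alpha> - x) = \<psi> x \<and> \<psi>' (2 * pi - 2 * \<alpha> - x) = \<psi>' x"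
proof -
  have "0 < x" using x alpha_less alpha_pos by simp
  note m = swapped_moves[OF x(1) this x(3)]
  consider "x < pi - \<alpha>" | "x = pi - \<alpha>" | "x > pi - \<alpha>" by linarith
  then show ?thesis
  proof cases
    case 1
    then have 2: "swapped x (2 * pi - 4 * \<alpha> - x)" using m(4) x alpha_pos by simp
    then have "swapped (2 * pi - 4 * \<alpha> - x) (2 * pi - 4 * \<alpha> - x + 2 * \<alpha>)"
      using 1 x alpha_less alpha_pos by (intro swapped_moves(1)) (auto simp: swapped_def)
    moreover have "2 * pi - 4 * \<alpha> - x + 2 * \<alpha> = 2 * pi - 2 * \<alpha> - x" by simp
    ultimately show ?thesis using swapped_trans[OF 2] by metis
  next
    case 3
    then have 2: "swapped x (x - 2 * \<alpha>)" using m(2) x alpha_less alpha_pos by simp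
    then have "swapped (x - 2 * \<alpha>) (2 * pi - 4 * \<alpha> - (x - 2 * \<alpha>))"
      using 3 x alpha_less alpha_pos by (intro swapped_moves(4)) (auto simp: swapped_def)
    moreover have "2 * pi - 4 * \<alpha> - (x - 2 * \<alpha>) = 2 * pi - 2 * \<alpha> - x" by simp
    ultimately show ?thesis using swapped_trans[OF 2] by metis
  next
    case 2
    then have "2 * pi - 2 * \<alpha> - x = x" by simp
    then show ?thesis by metis
  qed
qed

abbreviation "folded \<equiv> circle_fold \<psi> \<psi>'"

text \<open>The points compared lie symmetrically about \<open>\<alpha>\<close>, respectively
  \<open>- \<alpha>\<close>. In opposite half circles the equality is one move of the chain; in the
  same half circle it is \<open>reflect_low\<close> or \<open>reflect_high\<close>.\<close>

lemma folded_reflect: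
  assumes "generic t"
  shows "folded (t + 2 * \<alpha>) = folded (- t)" "folded (t - 2 * \<alpha>) = folded (- t)"
proof -
  obtain s l where s: "- pi \<le> s" "s < pi" "t = s + 2 * pi * of_int l" by (rule reduce_mod_2pi)
  have gs: "generic s"
    using orbitwise_translate[OF assms[unfolded generic_def], of 0 "- l"] s(3) unfolding generic_def by simp
  have gms: "generic (- s)" using gs orbitwise_minus unfolding generic_def by blast
  have ne: "s \<noteq> 0" "s \<noteq> - pi" "s \<noteq> 2 * \<alpha>" "s \<noteq> - 2 * \<alpha>" "s \<noteq> pi - 2 * \<alpha>" "s \<noteq> 2 * \<alpha> - pi"
    using generic_neq[OF gs] by auto
  \<comment> \<open>Here and in \<open>neg\<close>, the integer \<open>j\<close> counts the full
    turns that bring \<open>s + c\<close> back into the fundamental interval.\<close>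
  have pos: "folded (t + c) = \<psi> v" if "v = s + c + 2 * pi * of_int j" "0 < v" "v < pi" for c v and j :: int
    using circle_fold_eq[of v "t + c" "l - j"] that s(3) by (simp add: algebra_simps)
  have neg: "folded (t + c) = \<psi>' v" if "- v = s + c + 2 * pi * of_int j" "0 < v" "v < pi" for c v and j :: int
  proof -
    have "t + c = - v + 2 * pi * of_int (l - j)" using that(1) s(3) by (simp add: algebra_simps)
    from circle_fold_eq[OF _ _ this, of \<psi> \<psi>'] that(2,3) show ?thesis by simp
  qed
  have ms: "folded (- t) = (if s < 0 then \<psi> (- s) else \<psi>' s)"
    using circle_fold_eq[of "- s" "- t" "- l"] s ne(1,2) by auto
  note a = alpha_pos alpha_less
  show "folded (t + 2 * \<alpha>) = folded (- t)"
  proof -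
    consider "0 < s" "s < pi - 2 * \<alpha>" | "pi - 2 * \<alpha> < s" | "- 2 * \<alpha> < s" "s < 0" | "- pi < s" "s < - 2 * \<alpha>"
      using s(1,2) ne(1,2,4,5) by linarith
    then show ?thesis
    proof cases
      case 1
      note c = this
      have "folded (t + 2 * \<alpha>) = \<psi> (s + 2 * \<alpha>)"
        by (rule pos[where j = "0"]; use c a s(2) in simp)
      moreover have "folded (- t) = \<psi>' s"
        using c ms a by simp
      ultimately show ?thesis using swapped_moves(1)[OF gs 1(1) s(2) 1(2)] by (simp add: swapped_def)
    next
      case 2
      note c = this
      have "folded (t + 2 * \<alpha>) = \<psi>' (2 * pi - 2 * \<alpha> - s)"
        by (rule neg[where j = "- 1"]; use c a s(2) in simp)
      moreover have "folded (- t) = \<psi>' s"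
        using c ms a by simp
      ultimately show ?thesis using reflect_high[OF gs 2 s(2)] by simp
    next
      case 3
      note c = this
      have "folded (t + 2 * \<alpha>) = \<psi> (2 * \<alpha> - - s)"
        by (rule pos[where j = "0"]; use c a s(2) in simp)
      moreover have "folded (- t) = \<psi> (- s)"
        using c ms a by simp
      ultimately show ?thesis using reflect_low[OF gms] 3 by simp
    next
      case 4
      note c = this
      have "folded (t + 2 * \<alpha>) = \<psi>' (- s - 2 * \<alpha>)"
        by (rule neg[where j = "0"]; use c a s(2) in simp)
      moreover have "folded (- t) = \<psi> (- s)"
        using c ms a by simp
      ultimately show ?thesis using swapped_moves(2)[OF gms] 4 a by (simp add: swapped_def)
    qed
  qed
  have "folded (t + (- 2 * \<alpha>)) = folded (- t)"
  proof -
    consider "2 * \<alpha> < s" | "0 < s" "s < 2 * \<alpha>" | "2 * \<alpha> - pi < s" "s < 0" | "- pi < s" "s < 2 * \<alpha> - pi"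
      using s(1,2) ne(1,2,3,6) by linarith
    then show ?thesis
    proof cases
      case 1
      note c = this
      have "folded (t + (- 2 * \<alpha>)) = \<psi> (s - 2 * \<alpha>)"
        by (rule pos[where j = "0"]; use c a s(2) in simp)
      moreover have "folded (- t) = \<psi>' s"
        using c ms a by simp
      ultimately show ?thesis using swapped_moves(2)[OF gs] 1 a s(2) by (simp add: swapped_def)
    next
      case 2
      note c = this
      have "folded (t + (- 2 * \<alpha>)) = \<psi>' (2 * \<alpha> - s)"
        by (rule neg[where j = "0"]; use c a s(2) in simp)
      moreover have "folded (- t) = \<psi>' s"
        using c ms a by simp
      ultimately show ?thesis using reflect_low[OF gs] 2 by simp
    next
      case 3
      note c = this
      have "folded (t + (- 2 * \<alpha>)) = \<psi>' (- s + 2 * \<alpha>)"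
        by (rule neg[where j = "0"]; use c a s(2) in simp)
      moreover have "folded (- t) = \<psi> (- s)"
        using c ms a by simp
      ultimately show ?thesis using swapped_moves(1)[OF gms] 3 a by (simp add: swapped_def)
    next
      case 4
      note c = this
      have "folded (t + (- 2 * \<alpha>)) = \<psi> (2 * pi - 2 * \<alpha> - - s)"
        by (rule pos[where j = "1"]; use c a s(2) in simp)
      moreover have "folded (- t) = \<psi> (- s)"
        using c ms a by simp
      moreover have "\<psi> (2 * pi - 2 * \<alpha> - - s) = \<psi> (- s)" 
        using reflect_high[OF gms] 4 a by simp
      ultimately show ?thesis by metis
    qed
  qed
  then show "folded (t - 2 * \<alpha>) = folded (- t)" by simp
qed

text \<open>Two reflections compose to the translation by twice the distance of their
  centres.\<close>

lemma folded_translate: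
  assumes "generic t"
  shows "folded (t + 4 * \<alpha>) = folded t"
proof -
  have "generic (t + 2 * \<alpha>)"
    using orbitwise_translate[of _ t 1 0] assms unfolding generic_def by simp
  moreover have "generic (- t)" using assms orbitwise_minus unfolding generic_def by blast
  ultimately show ?thesis
    using folded_reflect(1)[of "t + 2 * \<alpha>"] folded_reflect(2)[of "- t"] by (simp add: add.commute)
qed

text \<open>The folded function is almost everywhere invariant under an irrational rotation, hence
  constant, and it coincides with \<open>\<psi>\<close> on the open interval from 0 to
  \<open>pi\<close>.\<close>

lemma edge_pair_const:
  assumes unit: "unit_fun \<psi>" "unit_fun \<psi>'" and irr: "\<alpha> / (2 * pi) \<notin> \<rat>"
  obtains \<kappa> where "AE x in sine_measure. \<psi> x = \<kappa>"
proof -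
  have "bounded_density folded"
  proof
    show "folded \<in> borel_measurable borel" using unit by (intro circle_fold_measurable) auto
    show "0 \<le> folded x" "folded x \<le> 1" for x
      using unit_funD[OF unit(1)] unit_funD[OF unit(2)] by (auto simp: circle_fold_def Let_def)
  qed
  moreover have "4 * \<alpha> / (2 * pi) \<notin> \<rat>"
  proof
    assume "4 * \<alpha> / (2 * pi) \<in> \<rat>"
    then have "(4 * \<alpha> / (2 * pi)) / 4 \<in> \<rat>" by (rule Rats_divide) simp
    with irr show False by simp
  qed
  moreover have "AE t in lborel. folded (t + 4 * \<alpha>) = folded t"
    using AE_generic by eventually_elim (rule folded_translate)
  ultimately obtain \<kappa> where \<kappa>: "AE t in lborel. folded t = \<kappa>"
    using irrational_rotation_ergodic[of folded "2 * pi" "4 * \<alpha>"] alpha_pos circle_fold_periodic by auto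
  then have "AE x in sine_measure. \<psi> x = \<kappa>"
    unfolding AE_sine_measure_iff
  proof eventually_elim
    case (elim x)
    then show ?case using circle_fold_eq[of x x 0 \<psi> \<psi>'] by auto
  qed
  then show ?thesis by (rule that)
qed

end

section \<open>From constant limits to constant members\<close>

context backward_sequence
begin

lemma integral_phi: "(\<integral>x. \<phi> n x \<partial>sine_measure) = (\<integral>x. \<phi> 0 x \<partial>sine_measure)"
proof (induction n)
  case (Suc n)
  have "(\<integral>x. \<phi> (Suc n) x \<partial>sine_measure) = (\<integral>x. Q (\<phi> (Suc n)) x \<partial>sine_measure)"
    by (rule integral_Q[OF unit, symmetric])
  also have "\<dots> = (\<integral>x. \<phi> n x \<partial>sine_measure)"
    by (rule integral_sine_cong) (auto simp: backward)
  finally show ?case using Suc by simp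
qed simp

text \<open>The vanishing edge differences carry convergence of \<open>\<phi> (2 * r i)\<close> at
  \<open>x\<close> over to the next index at \<open>\<tau> k x\<close>. Hence the limits along
  \<open>2 * r i\<close> and along its successors form an edge pair.\<close>

lemma phi_even_const:
  assumes irr: "\<alpha> / (2 * pi) \<notin> \<rat>"
  obtains r \<kappa> where "strict_mono r" "AE x in sine_measure. (\<lambda>i. \<phi> (2 * r i) x) \<longlonglongrightarrow> \<kappa>"
proof -
  obtain r where r: "strict_mono r" "AE x in sine_measure. Cauchy (\<lambda>i. \<phi> (2 * r i) x)"
    by (rule phi_even_subseq)
  define \<psi> where "\<psi> x = clamped_lim (\<lambda>i. \<phi> (2 * r i) x)" for x
  define \<psi>' where "\<psi>' x = clamped_lim (\<lambda>i. \<phi> (Suc (2 * r i)) x)" for x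
  define good where "good x \<longleftrightarrow> (0 < x \<and> x < pi \<longrightarrow> Cauchy (\<lambda>i. \<phi> (2 * r i) x) \<and>
     (\<forall>k\<in>{1..4}. p k x > 0 \<longrightarrow> (\<lambda>n. \<phi> (Suc n) (\<tau> k x) - \<phi> n x) \<longlonglongrightarrow> 0))" for x
  have clamp: "clamped_lim (\<lambda>i. \<phi> (f i) x) = L" if "(\<lambda>i. \<phi> (f i) x) \<longlonglongrightarrow> L" for f x L
    using clamped_lim_eq[OF that] unit_funD[OF unit] by simp
  have r2: "strict_mono (\<lambda>i. 2 * r i)"
    using r(1) by (simp add: strict_mono_def)
  interpret edge_pair \<alpha> \<psi> \<psi>' good
  proof
    show "AE x in lborel. good x"
      using phi_along_edges r(2) unfolding AE_sine_measure_iff good_def by eventually_elim simp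
    fix x k assume "good x" and x: "0 < x" "x < pi" and k: "k \<in> {1..4}" "p k x > 0"
    then have C: "Cauchy (\<lambda>i. \<phi> (2 * r i) x)" and d: "(\<lambda>n. \<phi> (Suc n) (\<tau> k x) - \<phi> n x) \<longlonglongrightarrow> 0"
      unfolding good_def by auto
    from C obtain L where L: "(\<lambda>i. \<phi> (2 * r i) x) \<longlonglongrightarrow> L"
      using Cauchy_convergent convergent_def by blast
    have "(\<lambda>i. \<phi> (Suc (2 * r i)) (\<tau> k x) - \<phi> (2 * r i) x) \<longlonglongrightarrow> 0"
      using LIMSEQ_subseq_LIMSEQ[OF d r2] by (simp add: o_def)
    from tendsto_add[OF this L] have "(\<lambda>i. \<phi> (Suc (2 * r i)) (\<tau> k x)) \<longlonglongrightarrow> L"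
      by simp
    then show "\<psi>' (\<tau> k x) = \<psi> x"
      unfolding \<psi>_def \<psi>'_def using clamp[OF L] clamp by simp
  qed
  have "unit_fun \<psi>" "unit_fun \<psi>'"
    unfolding unit_fun_def \<psi>_def[abs_def] \<psi>'_def[abs_def] clamped_lim_def by auto
  then obtain \<kappa> where "AE x in sine_measure. \<psi> x = \<kappa>"
    using irr by (rule edge_pair_const)
  with r(2) have "AE x in sine_measure. (\<lambda>i. \<phi> (2 * r i) x) \<longlonglongrightarrow> \<kappa>"
  proof eventually_elim
    case (elim x)
    then obtain L where L: "(\<lambda>i. \<phi> (2 * r i) x) \<longlonglongrightarrow> L"
      using Cauchy_convergent convergent_def by blast
    with elim(2) clamp[OF L] show ?case by (simp add: \<psi>_def)
  qed
  with r(1) show ?thesis by (rule that)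
qed

text \<open>Dominated convergence identifies \<open>\<kappa>\<close> with the common mean
  \<open>c\<close>, and the limit of the even correlations with \<open>c * c\<close>. These
  correlations increase, so \<open>corr (2 * n) \<le> c * c\<close>, and the variance of
  \<open>\<phi> n\<close> cannot be positive, whether \<open>n\<close> is even or odd.\<close>

theorem phi_const:
  assumes irr: "\<alpha> / (2 * pi) \<notin> \<rat>"
  shows "AE x in sine_measure. \<phi> n x = (\<integral>x. \<phi> 0 x \<partial>sine_measure)"
proof -
  define c where "c = (\<integral>x. \<phi> 0 x \<partial>sine_measure)"
  have mean: "(\<integral>x. \<phi> m x \<partial>sine_measure) = c" for m
    unfolding c_def by (rule integral_phi)
  obtain r \<kappa> where r: "strict_mono r" and lim: "AE x in sine_measure. (\<lambda>i. \<phi> (2 * r i) x) \<longlonglongrightarrow> \<kappa>"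
    using irr by (rule phi_even_const)
  have "(\<lambda>i. \<integral>x. \<phi> (2 * r i) x \<partial>sine_measure) \<longlonglongrightarrow> (\<integral>x. \<kappa> \<partial>sine_measure)"
    using lim unit_funD[OF unit] by (intro integral_dominated_convergence[where w = "\<lambda>_. 1"]) auto
  then have "(\<lambda>i. c) \<longlonglongrightarrow> \<kappa>"
    using sine.prob_space by (simp add: mean)
  then have c: "c = \<kappa>" by (simp add: LIMSEQ_const_iff)
  have "(\<lambda>i. \<integral>x. \<phi> (2 * r i) x * \<phi> (2 * r i) x \<partial>sine_measure) \<longlonglongrightarrow> (\<integral>x. \<kappa> * \<kappa> \<partial>sine_measure)"
    using unit_funD[OF unit_fun_mult[OF unit unit]]
  proof (intro integral_dominated_convergence[where w = "\<lambda>_. 1"])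
    show "AE x in sine_measure. (\<lambda>i. \<phi> (2 * r i) x * \<phi> (2 * r i) x) \<longlonglongrightarrow> \<kappa> * \<kappa>"
      using lim by eventually_elim (intro tendsto_mult)
  qed auto
  then have "(\<lambda>i. corr (2 * (2 * r i))) \<longlonglongrightarrow> \<kappa> * \<kappa>"
    using sine.prob_space by (simp add: integral_phi_mult flip: mult_2)
  moreover obtain l where l: "(\<lambda>n. corr (2 * n)) \<longlonglongrightarrow> l"
    using corr_even_convergent by (auto simp: convergent_def)
  moreover have "strict_mono (\<lambda>i. 2 * r i)" using r by (simp add: strict_mono_def)
  from LIMSEQ_subseq_LIMSEQ[OF l this] have "(\<lambda>i. corr (2 * (2 * r i))) \<longlonglongrightarrow> l" by (simp add: o_def)
  ultimately have "l = \<kappa> * \<kappa>" using LIMSEQ_unique by blast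
  then have le: "corr (2 * n) \<le> c * c"
    using incseq_le[OF corr_even_mono l, of n] c by simp
  define d where "d x = (\<phi> n x - c)\<^sup>2" for x
  have int: "integrable sine_measure (\<phi> n)" "integrable sine_measure (\<lambda>x. \<phi> n x * \<phi> n x)"
    by (rule integrable_unit_fun[OF unit] integrable_phi_mult)+
  have d: "d x = \<phi> n x * \<phi> n x - 2 * c * \<phi> n x + c * c" for x
    by (simp add: d_def power2_eq_square algebra_simps)
  have "integrable sine_measure d"
    unfolding d[abs_def] using int by simp
  moreover have "(\<integral>x. d x \<partial>sine_measure) = corr (2 * n) - 2 * c * c + c * c"
    unfolding d using int sine.prob_space by (simp add: integral_phi_mult mean flip: mult_2)
  then have "(\<integral>x. d x \<partial>sine_measure) \<le> 0" using le by simp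
  moreover have "0 \<le> d x" for x by (simp add: d_def)
  moreover from this have "(\<integral>x. d x \<partial>sine_measure) \<ge> 0" by simp
  ultimately have "AE x in sine_measure. d x = 0"
    by (intro integral_nonneg_eq_0_iff_AE[THEN iffD1] always_eventually allI order_antisym)
  then show ?thesis by eventually_elim (simp add: d_def c_def)
qed

end

section \<open>Saturations and exactness\<close>

context small_angle
begin

lemma measure_S_vimage:
  assumes "B \<in> sets lam_mu"
  shows "measure lam_mu (S -` B \<inter> Omega) = measure lam_mu B"
proof -
  have u: "unit_fun (fibre_measure B)"
    using assms fibre_measure_nonneg fibre_measure_le_1 by (auto simp: unit_fun_def)
  have "measure lam_mu (S -` B \<inter> Omega) = (\<integral>x. fibre_measure (S -` B \<inter> Omega) x \<partial>sine_measure)"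
    by (rule measure_lam_mu[OF S_vimage_sets[OF assms]])
  also have "\<dots> = (\<integral>x. Q (fibre_measure B) x \<partial>sine_measure)"
    using fibre_measure_measurable[OF S_vimage_sets[OF assms]] fibre_measure_measurable[OF assms]
      fibre_measure_vimage[OF assms]
    by (intro integral_sine_cong Q_measurable) auto
  also have "\<dots> = (\<integral>x. fibre_measure B x \<partial>sine_measure)"
    by (rule integral_Q[OF u])
  also have "\<dots> = measure lam_mu B"
    by (rule measure_lam_mu[OF assms, symmetric])
  finally show ?thesis .
qed

lemma S_pow_Suc: "(S ^^ Suc n) \<omega> = (S ^^ n) (S \<omega>)"
  by (simp add: funpow_swap1)

lemma S_pow_vimage_sets: "B \<in> sets lam_mu \<Longrightarrow> (S ^^ n) -` B \<inter> Omega \<in> sets lam_mu"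
  using measurable_sets[OF S_pow_measurable] by simp

lemma measure_S_pow_vimage:
  assumes "B \<in> sets lam_mu"
  shows "measure lam_mu ((S ^^ n) -` B \<inter> Omega) = measure lam_mu B"
proof (induction n)
  case 0
  have "B \<subseteq> Omega" using assms by (simp add: sets_lam_mu)
  then show ?case by (simp add: Int_absorb2)
next
  case (Suc n)
  have "(S ^^ Suc n) -` B \<inter> Omega = S -` ((S ^^ n) -` B \<inter> Omega) \<inter> Omega"
    using S_Omega by (auto simp: S_pow_Suc simp del: funpow.simps)
  then show ?case
    by (simp only: measure_S_vimage[OF S_pow_vimage_sets[OF assms]] Suc)
qed

text \<open>The points whose orbit eventually merges with the orbit of a point of \<open>A\<close>
  that was started \<open>n\<close> steps ahead.\<close>

definition saturation :: "(real \<times> real) set \<Rightarrow> nat \<Rightarrow> (real \<times> real) set" where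
  "saturation A n = (\<Union>m. (S ^^ m) -` ((S ^^ (m + n)) ` A) \<inter> Omega)"

lemma saturation_sets: "A \<in> sets lam_mu \<Longrightarrow> saturation A n \<in> sets lam_mu"
  unfolding saturation_def by (intro sets.countable_UN') (auto intro!: S_pow_vimage_sets S_pow_image_sets)

lemma S_pow_image_step: "(S ^^ m) \<omega> \<in> (S ^^ (m + n)) ` A \<Longrightarrow> (S ^^ Suc m) \<omega> \<in> (S ^^ (Suc m + n)) ` A"
  by auto

lemma saturation_vimage: "saturation A n = S -` saturation A (Suc n) \<inter> Omega"
proof (intro equalityI subsetI)
  fix \<omega> assume "\<omega> \<in> saturation A n"
  then obtain m where \<omega>: "\<omega> \<in> Omega" and m: "(S ^^ m) \<omega> \<in> (S ^^ (m + n)) ` A"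
    by (auto simp: saturation_def)
  from S_pow_image_step[OF m] have "(S ^^ m) (S \<omega>) \<in> (S ^^ (m + Suc n)) ` A"
    unfolding S_pow_Suc by simp
  then show "\<omega> \<in> S -` saturation A (Suc n) \<inter> Omega"
    using \<omega> S_Omega by (auto simp: saturation_def)
next
  fix \<omega> assume "\<omega> \<in> S -` saturation A (Suc n) \<inter> Omega"
  then obtain m where \<omega>: "\<omega> \<in> Omega" and m: "(S ^^ m) (S \<omega>) \<in> (S ^^ (m + Suc n)) ` A"
    by (auto simp: saturation_def)
  from m have "(S ^^ Suc m) \<omega> \<in> (S ^^ (Suc m + n)) ` A"
    unfolding S_pow_Suc by simp
  then show "\<omega> \<in> saturation A n"
    using \<omega> unfolding saturation_def by blast
qed

text \<open>The sets \<open>D m\<close> increase to \<open>saturation A 0\<close>, and invariance of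
  the measure gives \<open>D m\<close> the measure of the \<open>m\<close>-th image of
  \<open>A\<close>.\<close>

lemma saturation_measure_limit:
  assumes "A \<in> sets lam_mu"
  shows "(\<lambda>n. measure lam_mu ((S ^^ n) ` A)) \<longlonglongrightarrow> measure lam_mu (saturation A 0)"
proof -
  define D where "D m = (S ^^ m) -` ((S ^^ m) ` A) \<inter> Omega" for m
  have D: "D m \<in> sets lam_mu" for m
    unfolding D_def using assms by (intro S_pow_vimage_sets S_pow_image_sets)
  have "incseq D"
    by (rule incseq_SucI) (auto simp: D_def)
  with D have "(\<lambda>m. measure lam_mu (D m)) \<longlonglongrightarrow> measure lam_mu (\<Union>m. D m)"
    by (intro lm.finite_Lim_measure_incseq) auto
  moreover have "measure lam_mu (D m) = measure lam_mu ((S ^^ m) ` A)" for m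
    unfolding D_def using assms by (intro measure_S_pow_vimage S_pow_image_sets)
  ultimately show ?thesis by (simp add: saturation_def D_def)
qed

lemma subset_saturation: "A \<subseteq> Omega \<Longrightarrow> A \<subseteq> saturation A 0"
  unfolding saturation_def by (auto intro!: exI[of _ 0])

text \<open>The factor \<open>fibre_measure Omega x\<close> is 1 on \<open>[0, pi]\<close> and 0
  elsewhere. With it the equality holds almost everywhere on the line, so it can be transported by
  \<open>\<tau> k\<close> and starts the induction over words.\<close>

lemma saturation_fibres:
  assumes A: "A \<in> sets lam_mu" and irr: "\<alpha> / (2 * pi) \<notin> \<rat>"
  shows "AE x in lborel. fibre_measure (saturation A n) x = measure lam_mu (saturation A 0) * fibre_measure Omega x"
proof -
  interpret backward_sequence \<alpha> "\<lambda>n. fibre_measure (saturation A n)"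
  proof
    show "unit_fun (fibre_measure (saturation A n))" for n
      using saturation_sets[OF A] fibre_measure_nonneg fibre_measure_le_1 by (auto simp: unit_fun_def)
    show "fibre_measure (saturation A n) x = Q (fibre_measure (saturation A (Suc n))) x" if "0 \<le> x" "x \<le> pi" for x n
      using fibre_measure_vimage[OF saturation_sets[OF A] that, of "Suc n"] saturation_vimage[of A n] by simp
  qed
  have "AE x in sine_measure. fibre_measure (saturation A n) x = measure lam_mu (saturation A 0)"
    using phi_const[OF irr] by (simp add: measure_lam_mu[OF saturation_sets[OF A]])
  then have "AE x in lborel. 0 < x \<and> x < pi \<longrightarrow> fibre_measure (saturation A n) x = measure lam_mu (saturation A 0)"
    by (simp only: AE_sine_measure_iff)
  moreover have "AE x in lborel. x \<noteq> 0" "AE x in lborel. x \<noteq> pi"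
    by (rule AE_lborel_singleton)+
  ultimately show ?thesis
  proof eventually_elim
    case (elim x)
    have "saturation A n \<subseteq> Omega" using saturation_sets[OF A] by (simp add: sets_lam_mu)
    show ?case
    proof (cases "x \<in> {0..pi}")
      case True
      with elim show ?thesis by (auto simp: fibre_measure_Omega)
    next
      case False
      then show ?thesis
        using fibre_measure_eq_0[OF \<open>saturation A n \<subseteq> Omega\<close> False] fibre_measure_eq_0[OF order_refl False] by simp
    qed
  qed
qed

lemma AE_lborel_tau:
  assumes "AE x in lborel. P x"
  shows "AE x in lborel. P (\<tau> k x)"
proof -
  have t: "\<tau> k = (\<lambda>x. \<tau> k 0 + (if k = 1 \<or> k = 3 then 1 else - 1) * x)"
    by (auto simp: tau_def fun_eq_iff)
  show ?thesis
    by (subst t) (rule AE_lborel_affine[OF assms], simp)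
qed

section \<open>Cylinders and independence\<close>

lemma J_word_Nil: "J_word \<alpha> [] = Omega"
  by (simp add: J_word_def)

text \<open>A word is read along the orbit from its right end, so its last letter governs the first
  step.\<close>

lemma J_word_snoc: "J_word \<alpha> (w @ [k]) = J k \<inter> S -` J_word \<alpha> w"
proof (intro equalityI subsetI)
  fix \<omega> assume "\<omega> \<in> J_word \<alpha> (w @ [k])"
  then have \<omega>: "\<omega> \<in> Omega" and J: "m < Suc (length w) \<Longrightarrow> (S ^^ m) \<omega> \<in> J ((w @ [k]) ! (length w - m))" for m
    by (auto simp: J_word_def)
  have "(S ^^ m) (S \<omega>) \<in> J (w ! (length w - Suc m))" if "m < length w" for m
  proof -
    have "length w - Suc m < length w" using that by linarith
    then show ?thesis using J[of "Suc m"] that by (simp add: nth_append funpow_swap1)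
  qed
  then show "\<omega> \<in> J k \<inter> S -` J_word \<alpha> w"
    using J[of 0] S_Omega[OF \<omega>] by (simp add: J_word_def)
next
  fix \<omega> assume *: "\<omega> \<in> J k \<inter> S -` J_word \<alpha> w"
  have "(S ^^ m) \<omega> \<in> J ((w @ [k]) ! (length w - m))" if "m < Suc (length w)" for m
  proof (cases m)
    case (Suc m')
    with * that show ?thesis by (auto simp: J_word_def nth_append funpow_swap1)
  qed (use * in simp)
  then show "\<omega> \<in> J_word \<alpha> (w @ [k])"
    using * J_subset by (auto simp: J_word_def)
qed

lemma J_word_sets: "set w \<subseteq> {1..4} \<Longrightarrow> J_word \<alpha> w \<in> sets lam_mu"
proof (induction w rule: rev_induct)
  case Nil
  then show ?case using sets.top[of lam_mu] by (simp add: J_word_Nil)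
next
  case (snoc k w)
  then show ?case unfolding J_word_snoc by (intro J_S_vimage_sets) auto
qed

text \<open>Peeling off the first step gives both sides the same factor \<open>p k x\<close> and
  moves the base point to \<open>\<tau> k x\<close>. It also turns \<open>n\<close> into
  \<open>Suc n\<close>, which is why \<open>n\<close> varies in the induction.\<close>

lemma saturation_word_fibres:
  assumes A: "A \<in> sets lam_mu" and irr: "\<alpha> / (2 * pi) \<notin> \<rat>" and w: "set w \<subseteq> {1..4}"
  shows "AE x in lborel. fibre_measure (saturation A n \<inter> J_word \<alpha> w) x =
    measure lam_mu (saturation A 0) * fibre_measure (J_word \<alpha> w) x"
  using w
proof (induction w arbitrary: n rule: rev_induct)
  case Nil
  have "saturation A n \<inter> Omega = saturation A n"
    using saturation_sets[OF A] by (auto simp: sets_lam_mu)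
  then show ?case using saturation_fibres[OF A irr] by (simp add: J_word_Nil)
next
  case (snoc k w)
  then have k: "k \<in> {1..4}" and w: "set w \<subseteq> {1..4}" by auto
  let ?c = "measure lam_mu (saturation A 0)"
  have sets: "saturation A (Suc n) \<inter> J_word \<alpha> w \<in> sets lam_mu" "J_word \<alpha> w \<in> sets lam_mu"
    using saturation_sets[OF A] J_word_sets[OF w] by auto
  have eq: "saturation A n \<inter> J_word \<alpha> (w @ [k]) = J k \<inter> S -` (saturation A (Suc n) \<inter> J_word \<alpha> w)"
    unfolding saturation_vimage[of A n] J_word_snoc using J_subset by blast
  have "AE x in lborel. fibre_measure (saturation A (Suc n) \<inter> J_word \<alpha> w) (\<tau> k x) = ?c * fibre_measure (J_word \<alpha> w) (\<tau> k x)"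
    by (rule AE_lborel_tau[OF snoc.IH[OF w]])
  then show ?case
  proof eventually_elim
    case (elim x)
    show ?case
    proof (cases "x \<in> {0..pi}")
      case True
      then show ?thesis
        unfolding eq unfolding J_word_snoc
        using fibre_measure_J[OF sets(1) k, of x] fibre_measure_J[OF sets(2) k, of x] elim
        by (simp add: mult_ac del: vimage_Int)
    next
      case False
      have "saturation A n \<inter> J_word \<alpha> (w @ [k]) \<subseteq> Omega" "J_word \<alpha> (w @ [k]) \<subseteq> Omega"
        by (auto simp: J_word_def)
      then show ?thesis using fibre_measure_eq_0[OF _ False] by simp
    qed
  qed
qed

lemma fibre_measure_snd_vimage: "fibre_measure (snd -` U \<inter> B) x = indicator U x * fibre_measure B x"
  by (auto simp: fibre_measure_def indicator_def)

definition cylinders :: "(real \<times> real) set set" where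
  "cylinders = {snd -` U \<inter> J_word \<alpha> w | U w. U \<in> sets (restrict_space borel {0..pi}) \<and> set w \<subseteq> {1..4}}"

lemma cylinders_subset: "cylinders \<subseteq> Pow Omega"
  by (auto simp: cylinders_def J_word_def)

lemma cylinders_sets: "cylinders \<subseteq> sets lam_mu"
proof
  fix X assume "X \<in> cylinders"
  then obtain U w where X: "X = snd -` U \<inter> J_word \<alpha> w" "U \<in> sets borel" "set w \<subseteq> {1..4}"
    by (auto simp: cylinders_def sets_restrict_space_iff)
  have "(snd -` U :: (real \<times> real) set) \<in> sets borel" using measurable_sets[OF snd_borel X(2)] by simp
  then show "X \<in> sets lam_mu"
    using J_word_sets[OF X(3)] by (auto simp: X(1) sets_lam_mu)
qed

text \<open>Compared from the right end, either \<open>v\<close> is a suffix of \<open>w\<close>, or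
  some iterate would have to lie in two disjoint pieces.\<close>

lemma J_word_nested:
  assumes "set v \<subseteq> {1..4}" "set w \<subseteq> {1..4}" "length v \<le> length w"
  shows "J_word \<alpha> v \<inter> J_word \<alpha> w = J_word \<alpha> w \<or> J_word \<alpha> v \<inter> J_word \<alpha> w = {}"
proof (cases "\<forall>m < length v. v ! (length v - Suc m) = w ! (length w - Suc m)")
  case True
  then show ?thesis using assms(3) by (auto simp: J_word_def)
next
  case False
  then obtain m where m: "m < length v" "v ! (length v - Suc m) \<noteq> w ! (length w - Suc m)" by blast
  have "v ! (length v - Suc m) \<in> set v" "w ! (length w - Suc m) \<in> set w"
    using m(1) assms(3) by (auto intro!: nth_mem)
  then have "v ! (length v - Suc m) \<in> {1..4}" "w ! (length w - Suc m) \<in> {1..4}"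
    using assms by blast+
  then have "\<not> (\<omega> \<in> J_word \<alpha> v \<and> \<omega> \<in> J_word \<alpha> w)" for \<omega>
    using J_disjoint[of "(S ^^ m) \<omega>"] m assms(3) unfolding J_word_def by fastforce
  then show ?thesis by blast
qed

lemma cylinders_Int_stable: "Int_stable cylinders"
proof -
  have *: "(snd -` U \<inter> J_word \<alpha> v) \<inter> (snd -` V \<inter> J_word \<alpha> w) \<in> cylinders"
    if UV: "U \<in> sets (restrict_space borel {0..pi})" "V \<in> sets (restrict_space borel {0..pi})"
      and vw: "set v \<subseteq> {1..4}" "set w \<subseteq> {1..4}" "length v \<le> length w" for U V v w
    using J_word_nested[OF vw]
  proof
    assume "J_word \<alpha> v \<inter> J_word \<alpha> w = J_word \<alpha> w"
    then have "(snd -` U \<inter> J_word \<alpha> v) \<inter> (snd -` V \<inter> J_word \<alpha> w) = snd -` (U \<inter> V) \<inter> J_word \<alpha> w" by blast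
    then show ?thesis using UV vw unfolding cylinders_def by blast
  next
    assume "J_word \<alpha> v \<inter> J_word \<alpha> w = {}"
    then have "(snd -` U \<inter> J_word \<alpha> v) \<inter> (snd -` V \<inter> J_word \<alpha> w) = snd -` {} \<inter> J_word \<alpha> w" by blast
    then show ?thesis using vw unfolding cylinders_def by blast
  qed
  show ?thesis
  proof (rule Int_stableI)
    fix X Y assume "X \<in> cylinders" "Y \<in> cylinders"
    then obtain U v V w where X: "X = snd -` U \<inter> J_word \<alpha> v" "U \<in> sets (restrict_space borel {0..pi})" "set v \<subseteq> {1..4}"
      and Y: "Y = snd -` V \<inter> J_word \<alpha> w" "V \<in> sets (restrict_space borel {0..pi})" "set w \<subseteq> {1..4}"
      unfolding cylinders_def by blast
    show "X \<inter> Y \<in> cylinders"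
    proof (cases "length v \<le> length w")
      case True
      then show ?thesis using *[OF X(2) Y(2) X(3) Y(3)] X(1) Y(1) by simp
    next
      case False
      then show ?thesis using *[OF Y(2) X(2) Y(3) X(3)] X(1) Y(1) by (simp add: Int_commute)
    qed
  qed
qed

lemma saturation_cylinder:
  assumes A: "A \<in> sets lam_mu" and irr: "\<alpha> / (2 * pi) \<notin> \<rat>" and X: "X \<in> cylinders"
  shows "measure lam_mu (saturation A 0 \<inter> X) = measure lam_mu (saturation A 0) * measure lam_mu X"
proof -
  obtain U w where Xeq: "X = snd -` U \<inter> J_word \<alpha> w" and U: "U \<in> sets borel" and w: "set w \<subseteq> {1..4}"
    using X by (auto simp: cylinders_def sets_restrict_space_iff)
  let ?c = "measure lam_mu (saturation A 0)"
  have sets: "X \<in> sets lam_mu" "saturation A 0 \<inter> X \<in> sets lam_mu"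
    using X cylinders_sets saturation_sets[OF A] by auto
  have "AE x in lborel. fibre_measure (saturation A 0 \<inter> X) x = ?c * fibre_measure X x"
    using saturation_word_fibres[OF A irr w, of 0]
  proof eventually_elim
    case (elim x)
    have "saturation A 0 \<inter> X = snd -` U \<inter> (saturation A 0 \<inter> J_word \<alpha> w)" unfolding Xeq by blast
    then show ?case unfolding Xeq using elim by (simp only: fibre_measure_snd_vimage mult_ac)
  qed
  then have "AE x in sine_measure. fibre_measure (saturation A 0 \<inter> X) x = ?c * fibre_measure X x"
    unfolding AE_sine_measure_iff by eventually_elim simp
  then have "(\<integral>x. fibre_measure (saturation A 0 \<inter> X) x \<partial>sine_measure) = (\<integral>x. ?c * fibre_measure X x \<partial>sine_measure)"
    using fibre_measure_measurable[OF sets(1)] fibre_measure_measurable[OF sets(2)]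
    by (intro integral_cong_AE) auto
  then show ?thesis by (simp add: measure_lam_mu sets)
qed

text \<open>The measurable sets independent of \<open>saturation A 0\<close> form a Dynkin class,
  and it contains the intersection-stable cylinders.\<close>

lemma saturation_independent:
  assumes A: "A \<in> sets lam_mu" and irr: "\<alpha> / (2 * pi) \<notin> \<rat>" and X: "X \<in> sigma_sets Omega cylinders"
  shows "measure lam_mu (saturation A 0 \<inter> X) = measure lam_mu (saturation A 0) * measure lam_mu X"
proof -
  let ?C = "saturation A 0"
  have C: "?C \<in> sets lam_mu" "?C \<subseteq> Omega" using saturation_sets[OF A, of 0] by (auto simp: sets_lam_mu)
  have "X \<in> sets lam_mu \<and> measure lam_mu (?C \<inter> X) = measure lam_mu ?C * measure lam_mu X"
    using cylinders_Int_stable cylinders_subset X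
  proof (induction rule: sigma_sets_induct_disjoint)
    case (basic X)
    note b = this
    show ?case by (intro conjI saturation_cylinder[OF A irr b] subsetD[OF cylinders_sets b])
  next
    case (compl X)
    then have X: "X \<in> sets lam_mu" and e: "measure lam_mu (?C \<inter> X) = measure lam_mu ?C * measure lam_mu X"
      by blast+
    have "?C \<inter> (Omega - X) = ?C - ?C \<inter> X" using C(2) by blast
    then have "measure lam_mu (?C \<inter> (Omega - X)) = measure lam_mu ?C - measure lam_mu (?C \<inter> X)"
      by (simp only: lm.finite_measure_Diff[OF C(1) sets.Int[OF C(1) X] Int_lower1])
    also have "\<dots> = measure lam_mu ?C * (1 - measure lam_mu X)"
      unfolding e by (simp only: right_diff_distrib mult_1_right)
    also have "1 - measure lam_mu X = measure lam_mu (Omega - X)"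
      using lm.prob_compl[OF X] by simp
    finally have "measure lam_mu (?C \<inter> (Omega - X)) = measure lam_mu ?C * measure lam_mu (Omega - X)" .
    moreover have "Omega - X \<in> sets lam_mu" using sets.compl_sets[OF X] by simp
    ultimately show ?case by (rule conjI[rotated])
  next
    case (union X)
    have X: "range X \<subseteq> sets lam_mu" using union.IH by (intro image_subsetI) (rule conjunct1)
    have e: "measure lam_mu (?C \<inter> X i) = measure lam_mu ?C * measure lam_mu (X i)" for i
      using union.IH[of i] by (rule conjunct2)
    have "(\<lambda>i. measure lam_mu (X i)) sums measure lam_mu (\<Union>i. X i)"
      using X union(1) by (rule lm.finite_measure_UNION)
    then have 1: "(\<lambda>i. measure lam_mu ?C * measure lam_mu (X i)) sums (measure lam_mu ?C * measure lam_mu (\<Union>i. X i))"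
      by (rule sums_mult)
    have "(\<lambda>i. measure lam_mu (?C \<inter> X i)) sums measure lam_mu (\<Union>i. ?C \<inter> X i)"
    proof (rule lm.finite_measure_UNION)
      show "disjoint_family (\<lambda>i. ?C \<inter> X i)"
        using union(1) unfolding disjoint_family_on_def by blast
      show "range (\<lambda>i. ?C \<inter> X i) \<subseteq> sets lam_mu"
        using X C(1) by (intro image_subsetI sets.Int) auto
    qed
    then have "(\<lambda>i. measure lam_mu ?C * measure lam_mu (X i)) sums measure lam_mu (\<Union>i. ?C \<inter> X i)"
      unfolding e .
    from sums_unique2[OF this 1]
    have "measure lam_mu (?C \<inter> (\<Union>i. X i)) = measure lam_mu ?C * measure lam_mu (\<Union>i. X i)"
      by (simp only: Int_UN_distrib)
    moreover have "(\<Union>i. X i) \<in> sets lam_mu" using X by (rule sets.countable_UN)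
    ultimately show ?case by (rule conjI[rotated])
  qed simp
  then show ?thesis by simp
qed

section \<open>The generated sigma-algebra and exactness\<close>

lemma space_sigma_F [simp]: "space (sigma_F \<alpha>) = Omega"
  by (simp add: sigma_F_def space_measure_of_conv)

lemma space_sigma_Fn [simp]: "space (sigma_Fn \<alpha> n) = Omega"
  by (simp add: sigma_Fn_def space_measure_of_conv)

lemma sets_sigma_Fn: "sets (sigma_Fn \<alpha> n) = sigma_sets Omega
    {snd -` U \<inter> J_word \<alpha> is | U is. U \<in> sets (restrict_space borel {0..pi}) \<and> length is = n \<and> set is \<subseteq> {1..4}}"
  unfolding sigma_Fn_def by (rule sets_measure_of) (auto simp: J_word_def)

lemma sets_sigma_F: "sets (sigma_F \<alpha>) = sigma_sets Omega (\<Union>n\<in>{1..}. sets (sigma_Fn \<alpha> n))"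
  unfolding sigma_F_def using sets.sets_into_space[of _ "sigma_Fn \<alpha> _"]
  by (intro sets_measure_of) auto

lemma sets_sigma_Fn_subset: "n \<ge> 1 \<Longrightarrow> sets (sigma_Fn \<alpha> n) \<subseteq> sets (sigma_F \<alpha>)"
  unfolding sets_sigma_F by auto

lemma sigma_F_subset_cylinders: "sets (sigma_F \<alpha>) \<subseteq> sigma_sets Omega cylinders"
proof -
  have "sets (sigma_Fn \<alpha> n) \<subseteq> sigma_sets Omega cylinders" for n
    unfolding sets_sigma_Fn by (rule sigma_sets_mono') (auto simp: cylinders_def)
  then show ?thesis
    unfolding sets_sigma_F by (intro sigma_sets_mono) auto
qed

lemma sigma_F_subset_lam_mu: "sets (sigma_F \<alpha>) \<subseteq> sets lam_mu"
proof -
  have "sigma_sets (space lam_mu) cylinders \<subseteq> sets lam_mu"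
    using cylinders_sets by (rule sets.sigma_sets_subset)
  then show ?thesis using sigma_F_subset_cylinders by simp
qed

lemma subalgebra_sigma_F: "subalgebra lam_mu (sigma_F \<alpha>)"
  using sigma_F_subset_lam_mu by (simp add: subalgebra_def)

text \<open>On each piece \<open>J k\<close> a cylinder pulls back to a cylinder whose word is
  longer by one letter; its length is then at least one, so it lies in
  \<open>sigma_F \<alpha>\<close>.\<close>

lemma S_measurable_sigma_F: "S \<in> measurable (sigma_F \<alpha>) (sigma_F \<alpha>)"
proof -
  have gen: "S -` (snd -` U \<inter> J_word \<alpha> w) \<inter> Omega \<in> sets (sigma_F \<alpha>)"
    if U: "U \<in> sets (restrict_space borel {0..pi})" and w: "set w \<subseteq> {1..4}" for U w
  proof -
    have "J k \<inter> S -` (snd -` U \<inter> J_word \<alpha> w) \<in> sets (sigma_F \<alpha>)" if k: "k \<in> {1..4}" for k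
    proof -
      define V where "V = \<tau> k -` U \<inter> {0..pi}"
      have "U \<in> sets borel" using U by (simp add: sets_restrict_space_iff)
      from measurable_sets[OF tau_measurable this] have V: "V \<in> sets (restrict_space borel {0..pi})"
        by (simp add: V_def sets_restrict_space_iff)
      have "J k \<inter> S -` (snd -` U \<inter> J_word \<alpha> w) = snd -` V \<inter> J_word \<alpha> (w @ [k])"
      proof (rule set_eqI)
        fix \<omega>
        have "snd \<omega> \<in> {0..pi}" if "\<omega> \<in> J k"
          using J_subset[of k] that by (auto simp: Omega_def)
        then show "\<omega> \<in> J k \<inter> S -` (snd -` U \<inter> J_word \<alpha> w) \<longleftrightarrow> \<omega> \<in> snd -` V \<inter> J_word \<alpha> (w @ [k])"
          unfolding J_word_snoc V_def using branch_inverse_S(4)[OF _ k, of \<omega>] by auto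
      qed
      also have "\<dots> \<in> sets (sigma_Fn \<alpha> (Suc (length w)))"
        unfolding sets_sigma_Fn using V w k by (intro sigma_sets.Basic) (auto intro!: exI[of _ V] exI[of _ "w @ [k]"])
      also have "\<dots> \<subseteq> sets (sigma_F \<alpha>)" by (rule sets_sigma_Fn_subset) simp
      finally show ?thesis .
    qed
    then show ?thesis unfolding S_vimage_decomp by (intro sets.finite_UN) auto
  qed
  have Fn: "S \<in> measurable (sigma_F \<alpha>) (sigma_Fn \<alpha> n)" for n
    unfolding sigma_Fn_def
  proof (rule measurable_measure_of)
    fix X assume "X \<in> {snd -` U \<inter> J_word \<alpha> is | U is.
      U \<in> sets (restrict_space borel {0..pi}) \<and> length is = n \<and> set is \<subseteq> {1..4}}"
    then obtain U w where "X = snd -` U \<inter> J_word \<alpha> w" "U \<in> sets (restrict_space borel {0..pi})" "set w \<subseteq> {1..4}"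
      by blast
    then show "S -` X \<inter> space (sigma_F \<alpha>) \<in> sets (sigma_F \<alpha>)" by (simp only: gen space_sigma_F)
  qed (auto simp: J_word_def S_Omega)
  show ?thesis
    unfolding sigma_F_def[of \<alpha>]
  proof (rule measurable_measure_of, unfold sigma_F_def[symmetric])
    show "(\<Union>n\<in>{1..}. sets (sigma_Fn \<alpha> n)) \<subseteq> Pow Omega"
      using sets.sets_into_space[of _ "sigma_Fn \<alpha> _"] by auto
    show "S -` X \<inter> space (sigma_F \<alpha>) \<in> sets (sigma_F \<alpha>)" if "X \<in> (\<Union>n\<in>{1..}. sets (sigma_Fn \<alpha> n))" for X
      using that measurable_sets[OF Fn] by auto
  qed (auto simp: S_Omega)
qed

text \<open>As \<open>A\<close> lies inside its saturation, independence says that multiplying the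
  measure of \<open>A\<close> by that of the saturation changes nothing.\<close>

theorem measure_image_tendsto_1:
  assumes irr: "\<alpha> / (2 * pi) \<notin> \<rat>" and A: "A \<in> sets (sigma_F \<alpha>)" and pos: "measure lam_mu A > 0"
  shows "(\<lambda>n. measure lam_mu ((S ^^ n) ` A)) \<longlonglongrightarrow> 1"
proof -
  have A': "A \<in> sets lam_mu" "A \<in> sigma_sets Omega cylinders"
    using A sigma_F_subset_lam_mu sigma_F_subset_cylinders by auto
  have "saturation A 0 \<inter> A = A"
    using subset_saturation[of A] A'(1) by (auto simp: sets_lam_mu)
  with saturation_independent[OF A'(1) irr A'(2)] pos have "measure lam_mu (saturation A 0) = 1"
    by simp
  with saturation_measure_limit[OF A'(1)] show ?thesis by simp
qed

text \<open>If \<open>A\<close> is the preimage of \<open>B n\<close> under the \<open>n\<close>-th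
  iterate, the \<open>n\<close>-th image of \<open>A\<close> lies in \<open>B n\<close>, whose
  measure is that of \<open>A\<close> by invariance. For positive measure the images approach
  measure 1, so \<open>A\<close> already has it.\<close>

theorem exact_S:
  assumes irr: "\<alpha> / (2 * pi) \<notin> \<rat>"
  shows "exact_endomorphism (restr_to_subalg lam_mu (sigma_F \<alpha>)) S"
proof -
  let ?M = "restr_to_subalg lam_mu (sigma_F \<alpha>)"
  note sub = subalgebra_sigma_F
  have sp: "space ?M = Omega" and st: "sets ?M = sets (sigma_F \<alpha>)"
    using sub by (simp_all add: space_restr_to_subalg sets_restr_to_subalg)
  have me: "measure ?M B = measure lam_mu B" if "B \<in> sets (sigma_F \<alpha>)" for B
    using emeasure_restr_to_subalg[OF sub that] by (simp add: measure_def)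
  have "prob_space ?M"
    by (rule prob_space_restr_to_subalg[OF sub prob_space_lam_mu])
  moreover have "measure_preserving ?M S"
    unfolding measure_preserving_def
  proof
    show meas: "S \<in> measurable ?M ?M"
      using S_measurable_sigma_F by (simp only: measurable_cong_sets[OF st st])
    show "distr ?M ?M S = ?M"
    proof (rule measure_eqI)
      fix B assume "B \<in> sets (distr ?M ?M S)"
      then have B: "B \<in> sets (sigma_F \<alpha>)" "B \<in> sets lam_mu" using st sigma_F_subset_lam_mu by auto
      have pre: "S -` B \<inter> Omega \<in> sets (sigma_F \<alpha>)"
        using measurable_sets[OF S_measurable_sigma_F B(1)] by simp
      have "emeasure (distr ?M ?M S) B = emeasure ?M (S -` B \<inter> Omega)"
        using meas B by (simp add: emeasure_distr st sp)
      also have "\<dots> = emeasure lam_mu (S -` B \<inter> Omega)"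
        by (rule emeasure_restr_to_subalg[OF sub pre])
      also have "\<dots> = emeasure lam_mu B"
        using measure_S_vimage[OF B(2)] by (simp add: lm.emeasure_eq_measure)
      also have "\<dots> = emeasure ?M B"
        by (rule emeasure_restr_to_subalg[OF sub B(1), symmetric])
      finally show "emeasure (distr ?M ?M S) B = emeasure ?M B" .
    qed simp
  qed
  moreover have "measure ?M A = 0 \<or> measure ?M A = 1"
    if "A \<in> (\<Inter>n. {(S ^^ n) -` B \<inter> space ?M | B. B \<in> sets ?M})" for A
  proof (rule disjCI)
    assume nz: "measure ?M A \<noteq> 1"
    from that have "\<forall>n. \<exists>B. B \<in> sets (sigma_F \<alpha>) \<and> A = (S ^^ n) -` B \<inter> Omega"
      unfolding sp st by blast
    from choice[OF this] obtain B where "\<forall>n. B n \<in> sets (sigma_F \<alpha>) \<and> A = (S ^^ n) -` B n \<inter> Omega" ..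
    then have B: "B n \<in> sets (sigma_F \<alpha>)" "A = (S ^^ n) -` B n \<inter> Omega" for n by blast+
    have BO: "B n \<in> sets lam_mu" for n using B(1) sigma_F_subset_lam_mu by auto
    have "A = B 0" using B(2)[of 0] BO[of 0] by (simp add: sets_lam_mu Int_absorb2)
    then have A: "A \<in> sets (sigma_F \<alpha>)" using B(1) by simp
    have le: "measure lam_mu ((S ^^ n) ` A) \<le> measure lam_mu A" for n
    proof -
      have "(S ^^ n) ` A \<subseteq> B n" using B(2)[of n] by auto
      then have "measure lam_mu ((S ^^ n) ` A) \<le> measure lam_mu (B n)"
        using BO by (intro lm.finite_measure_mono) auto
      also have "\<dots> = measure lam_mu A"
        using measure_S_pow_vimage[OF BO, of n n] B(2)[of n] by simp
      finally show ?thesis .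
    qed
    have "measure lam_mu A \<ge> 1" if "measure lam_mu A > 0"
      by (rule LIMSEQ_le_const2[OF measure_image_tendsto_1[OF irr A that]]) (simp add: le)
    moreover have "measure lam_mu A \<le> 1" by (rule lm.prob_le_1)
    moreover have "measure lam_mu A \<noteq> 1" using nz me[OF A] by simp
    ultimately have "\<not> measure lam_mu A > 0" by linarith
    then show "measure ?M A = 0" using me[OF A] measure_nonneg[of lam_mu A] by linarith
  qed
  ultimately show ?thesis unfolding exact_endomorphism_def by (intro conjI ballI)
qed

end

theorem theorem14:
  fixes \<alpha> :: real
  assumes "0 < \<alpha>" and "\<alpha> < pi / 6" and "\<alpha> / (2 * pi) \<notin> \<rat>"
  shows "(\<forall>A \<in> sets (sigma_F \<alpha>). measure lam_mu A > 0 \<longrightarrow>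
            (\<lambda>n. measure lam_mu ((S_map \<alpha> ^^ n) ` A)) \<longlonglongrightarrow> 1) \<and>
         exact_endomorphism (restr_to_subalg lam_mu (sigma_F \<alpha>)) (S_map \<alpha>)"
proof -
  interpret small_angle \<alpha> by unfold_locales fact+
  show ?thesis
    by (intro conjI ballI impI measure_image_tendsto_1 exact_S assms(3))
qed

end
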